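(* Let $X$ be an infinite compact $0$-dimensional Hausdorff space. If $C(X)$ is countably saturated, then the Boolean algebra $CL(X)$ is countably saturated. Moreover, if $CL(X)$ is countably saturated, then $C(X)$ is countably quantifier-free saturated.
   Context: $C(X)$ is the C*-algebra of continuous complex-valued functions on $X$; $CL(X)$ is the Boolean algebra of clopen subsets of $X$; a space is $0$-dimensional if it has a basis of clopen sets. For compact $K\subseteq\mathbb{R}$ and $\epsilon>0$, $(K)_\epsilon=\{x\in\mathbb{R} : d(x,K)<\epsilon\}$; $A_{\le1}$ is the closed unit ball of a C*-algebra $A$. Formulas (continuous logic) are built from norms $\|P(\bar x)\|$ of $*$-polynomials by applying continuous real functions and taking $\sup$ and $\inf$ over variables ranging over the closed unit ball; a formula is quantifier-free if no $\sup$ or $\inf$ is used; parameters from $A$ may be substituted for variables. For a collection $\Phi$ of formulas, $A$ is countably $\Phi$-saturated if for every sequence $(\phi_n)_{n\in\mathbb{N}}$ of formulas from $\Phi$ with parameters from $A_{\le 1}$, in variables $(x_k)_{k\in\mathbb{N}}$ (finitely many in each $\phi_n$), and every sequence $(K_n)$ of compact subsets of $\mathbb{R}$, the following are equivalent: (1) there is a sequence $\bar b=(b_k)_{k\in\mathbb{N}}$ in $A_{\le1}$ with $\phi_n^A(\bar b)\in K_n$ for all $n$; (2) for every $\epsilon>0$ and finite $\Delta\subset\mathbb{N}$ there is a sequence $\bar b=(b_k)_{k\in\mathbb{N}}$ in $A_{\le1}$ with $\phi_n^A(\bar b)\in(K_n)_\epsilon$ for all $n\in\Delta$. $A$ is countably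 saturated if this holds with $\Phi$ the set of all formulas, and countably quantifier-free saturated if it holds with $\Phi$ the set of all quantifier-free formulas. A Boolean algebra $B$ is countably saturated if every finitely satisfiable countable type (with parameters from $B$) in the first-order language of Boolean algebras is realized in $B$. *)

theory Defs
  imports "HOL-Analysis.Analysis" "HOL-Algebra.Module"
begin

section \<open>The C*-algebra \<open>C(X)\<close>\<close>

record 'a star_algebra = "(complex, 'a) module" +
  adjoint :: "'a \<Rightarrow> 'a"
  anorm :: "'a \<Rightarrow> real"

definition unit_ball :: "('a, 'm) star_algebra_scheme \<Rightarrow> 'a set" where
  "unit_ball A = {a \<in> carrier A. anorm A a \<le> 1}"

text \<open>Elements are taken in \<^const>\<open>extensional\<close>, so that two of them are equal as HOL functions
  as soon as they agree on the space.\<close>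

definition continuous_functions :: "'x topology \<Rightarrow> ('x \<Rightarrow> complex) star_algebra" where
  "continuous_functions X =
    \<lparr>carrier = {f \<in> extensional (topspace X). continuous_map X euclidean f},
     monoid.mult = (\<lambda>f g. \<lambda>x\<in>topspace X. f x * g x),
     one = (\<lambda>x\<in>topspace X. 1),
     zero = (\<lambda>x\<in>topspace X. 0),
     add = (\<lambda>f g. \<lambda>x\<in>topspace X. f x + g x),
     smult = (\<lambda>c f. \<lambda>x\<in>topspace X. c * f x),
     adjoint = (\<lambda>f. \<lambda>x\<in>topspace X. cnj (f x)),
     anorm = (\<lambda>f. SUP x\<in>topspace X. cmod (f x))\<rparr>"

section \<open>Continuous logic and saturation\<close>

text \<open>Variables are indexed by natural numbers, and parameters are part of the syntax. Scalar
  constant terms of polynomials over a unital algebra are covered by the parameter \<open>1\<close>.\<close>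

datatype 'a star_poly =
    PVar nat
  | PParam 'a
  | PAdd "'a star_poly" "'a star_poly"
  | PMult "'a star_poly" "'a star_poly"
  | PScale complex "'a star_poly"
  | PStar "'a star_poly"

primrec poly_val :: "('a, 'm) star_algebra_scheme \<Rightarrow> (nat \<Rightarrow> 'a) \<Rightarrow> 'a star_poly \<Rightarrow> 'a" where
  "poly_val A v (PVar k) = v k"
| "poly_val A v (PParam a) = a"
| "poly_val A v (PAdd p q) = poly_val A v p \<oplus>\<^bsub>A\<^esub> poly_val A v q"
| "poly_val A v (PMult p q) = poly_val A v p \<otimes>\<^bsub>A\<^esub> poly_val A v q"
| "poly_val A v (PScale c p) = c \<odot>\<^bsub>A\<^esub> poly_val A v p"
| "poly_val A v (PStar p) = adjoint A (poly_val A v p)"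

text \<open>\<open>CApply u [\<phi>\<^sub>0, \<dots>, \<phi>\<^sub>n\<^sub>-\<^sub>1]\<close> stands for \<open>u(\<phi>\<^sub>0, \<dots>, \<phi>\<^sub>n\<^sub>-\<^sub>1)\<close>. A point of \<open>\<real>\<^sup>n\<close> is a sequence
  that vanishes from index \<open>n\<close> on, as in \<^const>\<open>Euclidean_space\<close>; continuity of \<open>u\<close> on \<open>\<real>\<^sup>n\<close> is
  imposed in \<open>continuous_connectives\<close>.\<close>

datatype 'a cformula =
    CNorm "'a star_poly"
  | CApply "(nat \<Rightarrow> real) \<Rightarrow> real" "'a cformula list"
  | CSup nat "'a cformula"
  | CInf nat "'a cformula"

fun continuous_connectives :: "'a cformula \<Rightarrow> bool" where
  "continuous_connectives (CNorm p) \<longleftrightarrow> True"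
| "continuous_connectives (CApply u \<phi>s) \<longleftrightarrow>
     continuous_map (Euclidean_space (length \<phi>s)) euclideanreal u \<and>
     (\<forall>\<phi>\<in>set \<phi>s. continuous_connectives \<phi>)"
| "continuous_connectives (CSup k \<phi>) \<longleftrightarrow> continuous_connectives \<phi>"
| "continuous_connectives (CInf k \<phi>) \<longleftrightarrow> continuous_connectives \<phi>"

fun quantifier_free :: "'a cformula \<Rightarrow> bool" where
  "quantifier_free (CNorm p) \<longleftrightarrow> True"
| "quantifier_free (CApply u \<phi>s) \<longleftrightarrow> (\<forall>\<phi>\<in>set \<phi>s. quantifier_free \<phi>)"
| "quantifier_free (CSup k \<phi>) \<longleftrightarrow> False"
| "quantifier_free (CInf k \<phi>) \<longleftrightarrow> False"

function cformula_val :: "('a, 'm) star_algebra_scheme \<Rightarrow> (nat \<Rightarrow> 'a) \<Rightarrow> 'a cformula \<Rightarrow> real" where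
  "cformula_val A v (CNorm p) = anorm A (poly_val A v p)"
| "cformula_val A v (CApply u \<phi>s) =
     u (\<lambda>i. if i < length \<phi>s then cformula_val A v (\<phi>s ! i) else 0)"
| "cformula_val A v (CSup k \<phi>) = (SUP a\<in>unit_ball A. cformula_val A (v(k := a)) \<phi>)"
| "cformula_val A v (CInf k \<phi>) = (INF a\<in>unit_ball A. cformula_val A (v(k := a)) \<phi>)"
  by pat_completeness auto
termination
  by (relation "Wellfounded.measure (\<lambda>(A, v, \<phi>). size \<phi>)")
     (auto simp: less_Suc_eq_le intro!: size_list_estimation'[OF nth_mem])

text \<open>\<^const>\<open>set_cformula\<close> collects the parameters of a formula.\<close>

definition all_formulas :: "('a, 'm) star_algebra_scheme \<Rightarrow> 'a cformula set" where
  "all_formulas A = {\<phi>. continuous_connectives \<phi> \<and> set_cformula \<phi> \<subseteq> unit_ball A}"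

definition quantifier_free_formulas :: "('a, 'm) star_algebra_scheme \<Rightarrow> 'a cformula set" where
  "quantifier_free_formulas A = {\<phi> \<in> all_formulas A. quantifier_free \<phi>}"

text \<open>This is \<open>{x. d(x, K) < \<epsilon>}\<close>. It is not phrased with \<^const>\<open>infdist\<close>, because
  \<open>infdist x {} = 0\<close>, whereas the neighbourhood of the empty set has to be empty.\<close>

definition thickening :: "real set \<Rightarrow> real \<Rightarrow> real set" where
  "thickening K \<epsilon> = (\<Union>y\<in>K. ball y \<epsilon>)"

definition countably_saturated_for ::
    "'a cformula set \<Rightarrow> ('a, 'm) star_algebra_scheme \<Rightarrow> bool" where
  "countably_saturated_for \<Phi> A \<longleftrightarrow>
    (\<forall>(\<phi> :: nat \<Rightarrow> 'a cformula) (K :: nat \<Rightarrow> real set).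
      (\<forall>n. \<phi> n \<in> \<Phi>) \<and> (\<forall>n. compact (K n)) \<longrightarrow>
      ((\<exists>b :: nat \<Rightarrow> 'a. (\<forall>k. b k \<in> unit_ball A) \<and> (\<forall>n. cformula_val A b (\<phi> n) \<in> K n))
       \<longleftrightarrow>
       (\<forall>\<epsilon>>0. \<forall>\<Delta> :: nat set. finite \<Delta> \<longrightarrow>
         (\<exists>b :: nat \<Rightarrow> 'a. (\<forall>k. b k \<in> unit_ball A) \<and>
           (\<forall>n\<in>\<Delta>. cformula_val A b (\<phi> n) \<in> thickening (K n) \<epsilon>)))))"

definition countably_saturated :: "('a, 'm) star_algebra_scheme \<Rightarrow> bool" where
  "countably_saturated A \<longleftrightarrow> countably_saturated_for (all_formulas A) A"

definition countably_qf_saturated :: "('a, 'm) star_algebra_scheme \<Rightarrow> bool" where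
  "countably_qf_saturated A \<longleftrightarrow> countably_saturated_for (quantifier_free_formulas A) A"

section \<open>Boolean algebras and first-order saturation\<close>

record 'b boolean_algebra_struct = "'b partial_object" +
  bmeet :: "'b \<Rightarrow> 'b \<Rightarrow> 'b"
  bjoin :: "'b \<Rightarrow> 'b \<Rightarrow> 'b"
  bcompl :: "'b \<Rightarrow> 'b"
  bbot :: 'b
  btop :: 'b

definition clopen_algebra :: "'x topology \<Rightarrow> 'x set boolean_algebra_struct" where
  "clopen_algebra X =
    \<lparr>carrier = {U. openin X U \<and> closedin X U},
     bmeet = (\<inter>), bjoin = (\<union>), bcompl = (\<lambda>U. topspace X - U),
     bbot = {}, btop = topspace X\<rparr>"

datatype 'b bterm =
    BVar nat
  | BParam 'b
  | BZero
  | BOne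
  | BMeet "'b bterm" "'b bterm"
  | BJoin "'b bterm" "'b bterm"
  | BCompl "'b bterm"

primrec bterm_val :: "('b, 'm) boolean_algebra_struct_scheme \<Rightarrow> (nat \<Rightarrow> 'b) \<Rightarrow> 'b bterm \<Rightarrow> 'b" where
  "bterm_val B v (BVar k) = v k"
| "bterm_val B v (BParam b) = b"
| "bterm_val B v BZero = bbot B"
| "bterm_val B v BOne = btop B"
| "bterm_val B v (BMeet s t) = bmeet B (bterm_val B v s) (bterm_val B v t)"
| "bterm_val B v (BJoin s t) = bjoin B (bterm_val B v s) (bterm_val B v t)"
| "bterm_val B v (BCompl t) = bcompl B (bterm_val B v t)"

datatype 'b bformula =
    BEq "'b bterm" "'b bterm"
  | BNot "'b bformula"
  | BAnd "'b bformula" "'b bformula"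
  | BEx nat "'b bformula"

primrec bformula_holds ::
    "('b, 'm) boolean_algebra_struct_scheme \<Rightarrow> (nat \<Rightarrow> 'b) \<Rightarrow> 'b bformula \<Rightarrow> bool" where
  "bformula_holds B v (BEq s t) \<longleftrightarrow> bterm_val B v s = bterm_val B v t"
| "bformula_holds B v (BNot \<phi>) \<longleftrightarrow> \<not> bformula_holds B v \<phi>"
| "bformula_holds B v (BAnd \<phi> \<psi>) \<longleftrightarrow> bformula_holds B v \<phi> \<and> bformula_holds B v \<psi>"
| "bformula_holds B v (BEx k \<phi>) \<longleftrightarrow> (\<exists>b\<in>carrier B. bformula_holds B (v(k := b)) \<phi>)"

text \<open>As for C*-algebras, a type may involve all of the variables \<open>(x\<^sub>k)\<^sub>k\<close>, each of its formulas
  finitely many. \<^const>\<open>set_bformula\<close> collects the parameters of a formula.\<close>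

definition countably_saturated_ba :: "('b, 'm) boolean_algebra_struct_scheme \<Rightarrow> bool" where
  "countably_saturated_ba B \<longleftrightarrow>
    (\<forall>T :: 'b bformula set.
      countable T \<and> (\<forall>\<phi>\<in>T. set_bformula \<phi> \<subseteq> carrier B) \<and>
      (\<forall>F. finite F \<and> F \<subseteq> T \<longrightarrow>
        (\<exists>v :: nat \<Rightarrow> 'b. (\<forall>k. v k \<in> carrier B) \<and> (\<forall>\<phi>\<in>F. bformula_holds B v \<phi>)))
      \<longrightarrow> (\<exists>v :: nat \<Rightarrow> 'b. (\<forall>k. v k \<in> carrier B) \<and> (\<forall>\<phi>\<in>T. bformula_holds B v \<phi>)))"

section \<open>Zero-dimensional spaces\<close>

definition zero_dimensional :: "'x topology \<Rightarrow> bool" where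
  "zero_dimensional X \<longleftrightarrow>
    (\<exists>\<B>. (\<forall>U\<in>\<B>. openin X U \<and> closedin X U) \<and> openin X = arbitrary union_of (\<lambda>U. U \<in> \<B>))"

end

theory Submission
  imports Defs
begin

text \<open>
  Both implications compare elements of \<open>C(X)\<close> with clopen subsets of \<open>X\<close>.

  For the first, a clopen set is the same thing as an idempotent of \<open>C(X)\<close>, namely its
  characteristic function. The difficulty is that continuous logic quantifies over the whole unit
  ball and not over the idempotents. It is overcome by making the translation robust: a first-order
  formula over \<open>CL(X)\<close> becomes a continuous formula whose value is exactly 0 (true) or exactly 1
  (false) at every tuple that is uniformly \<open>\<delta>\<close>-close to a tuple of characteristic functions, for
  some \<open>\<delta> > 0\<close> depending on the formula (\<open>bformula_as_cformula\<close>). An existential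
  quantifier is translated by an infimum over the ball together with a penalty, a large multiple of
  \<open>\<parallel>c\<^sup>2 - c\<parallel>\<close>. Unless \<open>c\<close> is close to a characteristic function the penalty is at least 1, and
  if it is close, the robustness of the subformula applies. A countable type over \<open>CL(X)\<close> then
  turns into the conditions that each \<open>x\<^sub>k\<close> is idempotent and that each translated formula is 0.

  For the second, the real and imaginary parts of every element of the unit ball of \<open>C(X)\<close> are
  rescaled to \<open>[0, 1]\<close> and expanded in convergent series whose digits are characteristic functions
  of clopen sets (\<open>unit_ball_digit_expansion\<close>).
  Finitely many digits of variables and parameters cut \<open>X\<close> into finitely many cells. Up to a small
  error, the value of a polynomial at a point depends only on the cell of the point, so its norm
  depends only on which cells are nonempty. Let \<open>c\<^sub>N\<close> satisfy the first \<open>N\<close> conditions of a type up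
  to an error that tends to 0. For suitable infinite sets of \<open>N\<close>, the answer to any finite number
  of questions whether a cell is empty is constant; the resulting answers form a
  countable, finitely satisfiable type over \<open>CL(X)\<close>. Clopen sets realizing it are the digits of a
  tuple \<open>b\<close> (\<open>realize_digit_patterns\<close>). For suitable \<open>r m \<ge> m\<close> each point of \<open>X\<close> can be
  matched, in both directions, with a point at which the first \<open>m\<close> digits of \<open>b\<close>, of \<open>c\<^bsub>r m\<^esub>\<close> and of the
  parameters correspond. Hence the norms of polynomials at \<open>c\<^bsub>r m\<^esub>\<close>, and with them the values of
  quantifier-free formulas, converge to those at \<open>b\<close> (\<open>cformula_val_tendsto\<close>), and the
  limits lie in the prescribed compact sets. Quantified formulas are out of reach of this
  argument, because the cells say nothing about other elements of the ball.
\<close>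

section \<open>Polynomials evaluated at a point\<close>

text \<open>Operations of \<open>C(X)\<close> are pointwise, so the value of a polynomial at a point is the value of a
  scalar polynomial: \<open>z\<close> are the values of the variables and \<open>w\<close> those of the parameters.\<close>

primrec pointwise_val :: "(nat \<Rightarrow> complex) \<Rightarrow> ('a \<Rightarrow> complex) \<Rightarrow> 'a star_poly \<Rightarrow> complex" where
  "pointwise_val z w (PVar k) = z k"
| "pointwise_val z w (PParam a) = w a"
| "pointwise_val z w (PAdd p q) = pointwise_val z w p + pointwise_val z w q"
| "pointwise_val z w (PMult p q) = pointwise_val z w p * pointwise_val z w q"
| "pointwise_val z w (PScale c p) = c * pointwise_val z w p"
| "pointwise_val z w (PStar p) = cnj (pointwise_val z w p)"

lemma poly_val_continuous_functions:
  assumes "x \<in> topspace X"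
  shows "poly_val (continuous_functions X) v p x = pointwise_val (\<lambda>k. v k x) (\<lambda>a. a x) p"
  using assms by (induction p) (auto simp: continuous_functions_def)

primrec poly_bound :: "'a star_poly \<Rightarrow> real" where
  "poly_bound (PVar k) = 1"
| "poly_bound (PParam a) = 1"
| "poly_bound (PAdd p q) = poly_bound p + poly_bound q"
| "poly_bound (PMult p q) = poly_bound p * poly_bound q"
| "poly_bound (PScale c p) = cmod c * poly_bound p"
| "poly_bound (PStar p) = poly_bound p"

lemma cmod_pointwise_val_le:
  assumes "\<And>k. cmod (z k) \<le> 1" "\<And>a. a \<in> set_star_poly p \<Longrightarrow> cmod (w a) \<le> 1"
  shows "cmod (pointwise_val z w p) \<le> poly_bound p"
  using assms(2)
proof (induction p)
  case (PAdd p q)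
  then show ?case
    by (auto intro!: order_trans[OF norm_triangle_ineq] add_mono)
next
  case (PMult p q)
  then show ?case
    by (auto simp: norm_mult intro!: mult_mono intro: order_trans[OF norm_ge_zero])
next
  case (PScale c p)
  then show ?case
    by (auto simp: norm_mult intro!: mult_left_mono)
qed (auto simp: assms(1))

text \<open>This is uniform continuity of a polynomial on the polydisc, in a form that lets the limit theorems
  do the \<open>\<epsilon>\<close>-management. A product needs the bound \<open>poly_bound\<close>.\<close>

lemma pointwise_val_diff_tendsto_0:
  fixes z z' :: "'i \<Rightarrow> nat \<Rightarrow> complex" and w w' :: "'i \<Rightarrow> 'a \<Rightarrow> complex"
  assumes "\<And>i k. cmod (z i k) \<le> 1" "\<And>i k. cmod (z' i k) \<le> 1"
    and "\<And>i a. a \<in> set_star_poly p \<Longrightarrow> cmod (w i a) \<le> 1"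
    and "\<And>i a. a \<in> set_star_poly p \<Longrightarrow> cmod (w' i a) \<le> 1"
    and "\<And>k. ((\<lambda>i. z i k - z' i k) \<longlongrightarrow> 0) F"
    and "\<And>a. a \<in> set_star_poly p \<Longrightarrow> ((\<lambda>i. w i a - w' i a) \<longlongrightarrow> 0) F"
  shows "((\<lambda>i. pointwise_val (z i) (w i) p - pointwise_val (z' i) (w' i) p) \<longlongrightarrow> 0) F"
  using assms(3,4,6)
proof (induction p)
  case (PVar k)
  then show ?case by (simp add: assms)
next
  case (PParam a)
  then show ?case by simp
next
  case (PAdd p q)
  then show ?case
    using tendsto_add[OF PAdd.IH(1) PAdd.IH(2)] by (simp add: algebra_simps)
next
  case (PMult p q)
  have C: "cmod (pointwise_val (z' i) (w' i) p) \<le> poly_bound p"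
    and D: "cmod (pointwise_val (z i) (w i) q) \<le> poly_bound q" for i
    using PMult.prems assms(1,2) by (auto intro!: cmod_pointwise_val_le)
  have 1: "((\<lambda>i. (pointwise_val (z i) (w i) p - pointwise_val (z' i) (w' i) p) * pointwise_val (z i) (w i) q) \<longlongrightarrow> 0) F"
    using PMult by (intro lim_null_mult_right_bounded[OF _ always_eventually, where B = "poly_bound q"]) (auto simp: D)
  have 2: "((\<lambda>i. pointwise_val (z' i) (w' i) p * (pointwise_val (z i) (w i) q - pointwise_val (z' i) (w' i) q)) \<longlongrightarrow> 0) F"
    using PMult by (intro lim_null_mult_left_bounded[OF always_eventually, where B = "poly_bound p"]) (auto simp: C)
  show ?case
    using tendsto_add[OF 1 2] by (simp add: algebra_simps)
next
  case (PScale c p)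
  then show ?case
    using tendsto_mult_left[OF PScale.IH, of c] by (simp add: algebra_simps)
next
  case (PStar p)
  then show ?case
    using tendsto_cnj[OF PStar.IH] by simp
qed

text \<open>A statement about all sequences of related pairs yields a uniform one: at each index take a
  counterexample if there is one. This recovers \<open>\<epsilon>\<close>-\<open>\<delta>\<close> statements from convergence.\<close>

lemma eventually_all_pairsI:
  assumes "\<And>n. \<exists>x y. R n x y"
    and "\<And>x y. (\<And>n. R n (x n) (y n)) \<Longrightarrow> \<forall>\<^sub>F n in F. Q n (x n) (y n)"
  shows "\<forall>\<^sub>F n in F. \<forall>x y. R n x y \<longrightarrow> Q n x y"
proof -
  have "\<exists>x y. R n x y \<and> (Q n x y \<longrightarrow> (\<forall>x y. R n x y \<longrightarrow> Q n x y))" for n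
    using assms(1)[of n] by blast
  then obtain x y where xy: "\<And>n. R n (x n) (y n)"
    "\<And>n. Q n (x n) (y n) \<Longrightarrow> \<forall>x y. R n x y \<longrightarrow> Q n x y"
    by metis
  show ?thesis
    using assms(2)[OF xy(1)] by (rule eventually_mono) (fact xy(2))
qed

section \<open>The unit ball of \<open>C(X)\<close> and the clopen sets\<close>

lemma cmod_continuous_functions_bdd:
  assumes "compact_space X" "f \<in> carrier (continuous_functions X)"
  shows "bdd_above ((\<lambda>x. cmod (f x)) ` topspace X)"
proof -
  have "compactin euclidean (f ` topspace X)"
    using assms by (intro image_compactin[where X = X])
      (auto simp: continuous_functions_def compact_space_def)
  then have "bounded (f ` topspace X)"
    by (simp add: compact_imp_bounded)
  then show ?thesis
    by (auto simp: bounded_iff bdd_above_def)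
qed

lemma unit_ball_continuous_functions:
  assumes "compact_space X" "topspace X \<noteq> {}"
  shows "f \<in> unit_ball (continuous_functions X) \<longleftrightarrow>
    f \<in> extensional (topspace X) \<and> continuous_map X euclidean f \<and> (\<forall>x\<in>topspace X. cmod (f x) \<le> 1)"
proof -
  have "(SUP x\<in>topspace X. cmod (f x)) \<le> 1 \<longleftrightarrow> (\<forall>x\<in>topspace X. cmod (f x) \<le> 1)"
    if "f \<in> carrier (continuous_functions X)"
    using cSUP_le_iff[OF assms(2) cmod_continuous_functions_bdd[OF assms(1) that]] .
  then show ?thesis
    unfolding unit_ball_def by (auto simp: continuous_functions_def)
qed

abbreviation poly_at :: "(nat \<Rightarrow> 'x \<Rightarrow> complex) \<Rightarrow> 'x \<Rightarrow> ('x \<Rightarrow> complex) star_poly \<Rightarrow> complex" where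
  "poly_at v x p \<equiv> pointwise_val (\<lambda>k. v k x) (\<lambda>a. a x) p"

lemma anorm_poly_val:
  "anorm (continuous_functions X) (poly_val (continuous_functions X) v p) =
    (SUP x\<in>topspace X. cmod (poly_at v x p))"
proof -
  have "anorm (continuous_functions X) f = (SUP x\<in>topspace X. cmod (f x))" for f
    by (simp add: continuous_functions_def)
  then show ?thesis
    by (simp add: poly_val_continuous_functions)
qed

lemma anorm_poly_val_leI:
  assumes "topspace X \<noteq> {}" "\<And>x. x \<in> topspace X \<Longrightarrow> cmod (poly_at v x p) \<le> c"
  shows "anorm (continuous_functions X) (poly_val (continuous_functions X) v p) \<le> c"
  unfolding anorm_poly_val using assms by (rule cSUP_least)

lemma cmod_poly_at_le_anorm:
  assumes "compact_space X" "x \<in> topspace X" "\<And>k. v k \<in> unit_ball (continuous_functions X)"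
    and "set_star_poly p \<subseteq> unit_ball (continuous_functions X)"
  shows "cmod (poly_at v x p) \<le> anorm (continuous_functions X) (poly_val (continuous_functions X) v p)"
proof -
  have "topspace X \<noteq> {}"
    using assms(2) by blast
  note unit_ball_continuous_functions[OF assms(1) this]
  then have ball: "cmod (f y) \<le> 1" if "f \<in> unit_ball (continuous_functions X)" "y \<in> topspace X" for f y
    using that by auto
  have "bdd_above ((\<lambda>x. cmod (poly_at v x p)) ` topspace X)"
    using assms(3,4) by (intro bdd_aboveI2[where M = "poly_bound p"] cmod_pointwise_val_le ball) auto
  then show ?thesis
    unfolding anorm_poly_val using assms(2) by (intro cSUP_upper)
qed

definition clopen :: "'x topology \<Rightarrow> 'x set \<Rightarrow> bool" where
  "clopen X U \<longleftrightarrow> openin X U \<and> closedin X U"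

lemma clopen_subset: "clopen X U \<Longrightarrow> U \<subseteq> topspace X"
  by (simp add: clopen_def openin_subset)

lemma carrier_clopen_algebra [simp]: "carrier (clopen_algebra X) = Collect (clopen X)"
  by (auto simp: clopen_algebra_def clopen_def)

lemma clopen_algebra_operations [simp]:
  "bmeet (clopen_algebra X) = (\<inter>)" "bcompl (clopen_algebra X) = (\<lambda>U. topspace X - U)"
  "bbot (clopen_algebra X) = {}" "btop (clopen_algebra X) = topspace X"
  by (simp_all add: clopen_algebra_def)

lemma bterm_val_clopen:
  assumes "\<And>k. clopen X (v k)" "\<And>U. U \<in> set_bterm t \<Longrightarrow> clopen X U"
  shows "clopen X (bterm_val (clopen_algebra X) v t)"
  using assms(2)
  by (induction t) (auto simp: clopen_algebra_def clopen_def assms(1)[unfolded clopen_def])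

lemma continuous_map_euclideanI:
  fixes f :: "'x \<Rightarrow> 'a::metric_space"
  assumes "\<And>x \<epsilon>. x \<in> topspace X \<Longrightarrow> \<epsilon> > 0 \<Longrightarrow> \<exists>U. openin X U \<and> x \<in> U \<and> (\<forall>y\<in>U. dist (f x) (f y) < \<epsilon>)"
  shows "continuous_map X euclidean f"
  using assms Met_TC.continuous_map_to_metric[of X f] by (simp add: mtopology_is_euclidean ball_def)

lemma continuous_map_of_bool_clopen:
  assumes "clopen X U"
  shows "continuous_map X euclidean (\<lambda>x. of_bool (x \<in> U) :: 'a :: {metric_space, zero_neq_one})"
proof (rule continuous_map_euclideanI)
  fix x and \<epsilon> :: real assume "x \<in> topspace X" "\<epsilon> > 0"
  then show "\<exists>V. openin X V \<and> x \<in> V \<and>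
      (\<forall>y\<in>V. dist (of_bool (x \<in> U) :: 'a) (of_bool (y \<in> U)) < \<epsilon>)"
    using assms by (intro exI[of _ "if x \<in> U then U else topspace X - U"])
      (auto simp: clopen_def openin_diff)
qed

definition char_fun :: "'x topology \<Rightarrow> 'x set \<Rightarrow> 'x \<Rightarrow> complex" where
  "char_fun X U = (\<lambda>x\<in>topspace X. of_bool (x \<in> U))"

lemma char_fun_in_unit_ball:
  assumes "compact_space X" "topspace X \<noteq> {}" "clopen X U"
  shows "char_fun X U \<in> unit_ball (continuous_functions X)"
proof -
  have "continuous_map X euclidean (char_fun X U)"
    by (rule continuous_map_eq[OF continuous_map_of_bool_clopen[OF assms(3)]]) (simp add: char_fun_def)
  then show ?thesis
    using assms by (simp add: unit_ball_continuous_functions) (simp add: char_fun_def)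
qed

section \<open>Boolean formulas as continuous formulas\<close>

primrec poly_of_bterm :: "'x topology \<Rightarrow> 'x set bterm \<Rightarrow> ('x \<Rightarrow> complex) star_poly" where
  "poly_of_bterm X (BVar k) = PVar k"
| "poly_of_bterm X (BParam U) = PParam (char_fun X U)"
| "poly_of_bterm X BZero = PParam (char_fun X {})"
| "poly_of_bterm X BOne = PParam (char_fun X (topspace X))"
| "poly_of_bterm X (BMeet s t) = PMult (poly_of_bterm X s) (poly_of_bterm X t)"
| "poly_of_bterm X (BJoin s t) = PAdd (poly_of_bterm X s) (PAdd (poly_of_bterm X t)
     (PScale (-1) (PMult (poly_of_bterm X s) (poly_of_bterm X t))))"
| "poly_of_bterm X (BCompl t) = PAdd (PParam (char_fun X (topspace X))) (PScale (-1) (poly_of_bterm X t))"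

lemma poly_of_bterm_char_fun:
  assumes "x \<in> topspace X"
  shows "pointwise_val (\<lambda>k. char_fun X (v k) x) (\<lambda>a. a x) (poly_of_bterm X t) =
    of_bool (x \<in> bterm_val (clopen_algebra X) v t)"
  using assms by (induction t) (auto simp: clopen_algebra_def char_fun_def)

lemma set_poly_of_bterm:
  "set_star_poly (poly_of_bterm X t) \<subseteq> char_fun X ` (set_bterm t \<union> {{}, topspace X})"
  by (induction t) auto

definition close_to_sets ::
    "'x topology \<Rightarrow> real \<Rightarrow> (nat \<Rightarrow> 'x \<Rightarrow> complex) \<Rightarrow> (nat \<Rightarrow> 'x set) \<Rightarrow> bool" where
  "close_to_sets X \<delta> a U \<longleftrightarrow> (\<forall>k. a k \<in> unit_ball (continuous_functions X) \<and> clopen X (U k) \<and>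
     (\<forall>x\<in>topspace X. cmod (a k x - char_fun X (U k) x) < \<delta>))"

text \<open>The required \<open>\<delta>\<close> is of the form \<open>1 / (n + 1)\<close>: the sequence of relations \<open>R n\<close> of being
  \<open>1 / (n + 1)\<close>-close turns convergence of the differences into a uniform bound.\<close>

lemma poly_at_close_to_sets:
  assumes X: "compact_space X" "topspace X \<noteq> {}"
    and p: "set_star_poly p \<subseteq> unit_ball (continuous_functions X)" and "\<epsilon> > 0"
  shows "\<exists>\<delta>>0. \<forall>a U x. close_to_sets X \<delta> a U \<and> x \<in> topspace X \<longrightarrow>
     cmod (poly_at a x p - poly_at (\<lambda>k. char_fun X (U k)) x p) < \<epsilon>"
proof -
  note ball = unit_ball_continuous_functions[OF X]
  note char = char_fun_in_unit_ball[OF X]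
  define R where "R n a y \<longleftrightarrow> close_to_sets X (1 / real (Suc n)) a (fst y) \<and> snd y \<in> topspace X" for n a y
  have "\<forall>\<^sub>F n in sequentially. \<forall>a y. R n a y \<longrightarrow>
     cmod (poly_at a (snd y) p - poly_at (\<lambda>k. char_fun X (fst y k)) (snd y) p) < \<epsilon>"
  proof (rule eventually_all_pairsI)
    fix n
    obtain x where "x \<in> topspace X" using X by blast
    then have "R n (\<lambda>k. char_fun X {}) (\<lambda>k. {}, x)"
      using char[of "{}"] by (simp add: R_def close_to_sets_def clopen_def)
    then show "\<exists>a y. R n a y" by blast
  next
    fix a y assume R: "\<And>n. R n (a n) (y n)"
    have "(\<lambda>n. a n k (snd (y n)) - char_fun X (fst (y n) k) (snd (y n))) \<longlonglongrightarrow> 0" for k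
    proof (rule Lim_null_comparison[OF _ LIMSEQ_Suc[OF lim_1_over_n]])
      show "\<forall>\<^sub>F n in sequentially. cmod (a n k (snd (y n)) - char_fun X (fst (y n) k) (snd (y n))) \<le> 1 / real (Suc n)"
        using R by (auto simp: R_def close_to_sets_def intro!: always_eventually less_imp_le)
    qed
    moreover have "cmod (a n k (snd (y n))) \<le> 1" "cmod (char_fun X (fst (y n) k) (snd (y n))) \<le> 1" for n k
      using R[of n] ball char[of "fst (y n) k"] by (auto simp: R_def close_to_sets_def)
    moreover have "cmod (f (snd (y n))) \<le> 1" if "f \<in> set_star_poly p" for n f
      using R[of n] ball that p by (auto simp: R_def)
    ultimately have "(\<lambda>n. poly_at (a n) (snd (y n)) p - poly_at (\<lambda>k. char_fun X (fst (y n) k)) (snd (y n)) p) \<longlonglongrightarrow> 0"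
      by (intro pointwise_val_diff_tendsto_0) auto
    then show "\<forall>\<^sub>F n in sequentially. cmod (poly_at (a n) (snd (y n)) p -
        poly_at (\<lambda>k. char_fun X (fst (y n) k)) (snd (y n)) p) < \<epsilon>"
      using \<open>\<epsilon> > 0\<close> by (auto dest!: tendstoD[of _ _ _ \<epsilon>])
  qed
  then obtain n where n: "\<And>a y. R n a y \<Longrightarrow>
     cmod (poly_at a (snd y) p - poly_at (\<lambda>k. char_fun X (fst y k)) (snd y) p) < \<epsilon>"
    using eventually_happens'[OF sequentially_bot] by blast
  show ?thesis
    using n[of _ "(_, _)"] by (intro exI[of _ "1 / real (Suc n)"]) (auto simp: R_def)
qed

definition idempotence_defect :: "nat \<Rightarrow> 'a star_poly" where
  "idempotence_defect k = PAdd (PMult (PVar k) (PVar k)) (PScale (-1) (PVar k))"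

lemma poly_at_idempotence_defect [simp]:
  "pointwise_val z w (idempotence_defect k) = z k * (z k - 1)"
  "set_star_poly (idempotence_defect k) = {}"
  by (simp_all add: idempotence_defect_def algebra_simps)

text \<open>If \<open>|z| |z - 1| < \<delta>\<^sup>2\<close>, then \<open>z\<close> lies within \<open>\<delta>\<close> of 0 or of 1, and for \<open>\<delta> \<le> 1 / 2\<close> not of both.
  Hence the set where the function is near 1 is open with open complement.\<close>

lemma almost_idempotent_close_to_char_fun:
  assumes X: "compact_space X" "topspace X \<noteq> {}"
    and v: "\<And>j. v j \<in> unit_ball (continuous_functions X)" and \<delta>: "0 < \<delta>" "\<delta> \<le> 1 / 2"
    and defect: "anorm (continuous_functions X) (poly_val (continuous_functions X) v (idempotence_defect k)) < \<delta>\<^sup>2"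
  shows "\<exists>U. clopen X U \<and> (\<forall>x\<in>topspace X. cmod (v k x - char_fun X U x) < \<delta>)"
proof -
  define U where "U = {x \<in> topspace X. v k x \<in> ball 1 \<delta>}"
  have cont: "continuous_map X euclidean (v k)"
    using v unit_ball_continuous_functions[OF X] by blast
  have alt: "cmod (v k x) < \<delta> \<or> cmod (1 - v k x) < \<delta>" if "x \<in> topspace X" for x
  proof (rule ccontr)
    assume "\<not> ?thesis"
    then have "\<delta> * \<delta> \<le> cmod (v k x) * cmod (v k x - 1)"
      using \<delta> by (intro mult_mono) (auto simp: norm_minus_commute)
    also have "\<dots> < \<delta>\<^sup>2"
      using cmod_poly_at_le_anorm[OF X(1) that, of v "idempotence_defect k"] v defect by (simp add: norm_mult)
    finally show False by (simp add: power2_eq_square)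
  qed
  have not_both: "\<not> (cmod z < \<delta> \<and> cmod (1 - z) < \<delta>)" for z
    using norm_triangle_ineq[of z "1 - z"] \<delta> by auto
  have "topspace X - U = {x \<in> topspace X. v k x \<in> ball 0 \<delta>}"
    using alt not_both by (auto simp: U_def dist_norm)
  moreover have op: "openin X {x \<in> topspace X. v k x \<in> ball c \<delta>}" for c :: complex
    using cont by (rule openin_continuous_map_preimage) simp
  ultimately have "openin X (topspace X - U)"
    by metis
  then have "clopen X U"
    using op[of 1] unfolding clopen_def closedin_def U_def by blast
  moreover have "cmod (v k x - char_fun X U x) < \<delta>" if "x \<in> topspace X" for x
    using alt[OF that] that by (auto simp: char_fun_def U_def dist_norm norm_minus_commute[of "v k x" 1])
  ultimately show ?thesis by blast
qed

lemma continuous_map_Euclidean_space_coordinate: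
  "continuous_map (Euclidean_space n) euclideanreal (\<lambda>r. r i)"
  unfolding Euclidean_space_def
  by (intro continuous_map_from_subtopology continuous_map_product_projection) simp

text \<open>The bound \<open>\<delta>\<close> makes the induction work: values at approximate characteristic functions are again
  exactly 0 or 1, so errors do not accumulate with the nesting of quantifiers. For an
  equation, the norm of the difference of the two terms is 0 or 1 at characteristic functions, hence
  at most \<open>1 / 3\<close> or at least \<open>2 / 3\<close> nearby, and a piecewise linear connective rounds it.\<close>

lemma bformula_as_cformula:
  assumes X: "compact_space X" "topspace X \<noteq> {}"
    and "set_bformula \<phi> \<subseteq> carrier (clopen_algebra X)"
  shows "\<exists>\<psi>\<in>all_formulas (continuous_functions X). \<exists>\<delta>>0. \<forall>a U. close_to_sets X \<delta> a U \<longrightarrow>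
    cformula_val (continuous_functions X) a \<psi> = of_bool (\<not> bformula_holds (clopen_algebra X) U \<phi>)"
  using assms(3)
proof (induction \<phi>)
  case (BEq s t)
  define p where "p = PAdd (poly_of_bterm X s) (PScale (-1) (poly_of_bterm X t))"
  have "set_star_poly p \<subseteq> char_fun X ` (set_bterm s \<union> set_bterm t \<union> {{}, topspace X})"
    using set_poly_of_bterm[of X s] set_poly_of_bterm[of X t] unfolding p_def by auto
  also have "\<dots> \<subseteq> unit_ball (continuous_functions X)"
    using BEq.prems by (intro image_subsetI char_fun_in_unit_ball[OF X]) (auto simp: clopen_def)
  finally have p: "set_star_poly p \<subseteq> unit_ball (continuous_functions X)" .
  obtain \<delta> where \<delta>: "\<delta> > 0" "\<And>a U x. close_to_sets X \<delta> a U \<Longrightarrow> x \<in> topspace X \<Longrightarrow>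
     cmod (poly_at a x p - poly_at (\<lambda>k. char_fun X (U k)) x p) < 1 / 3"
    using poly_at_close_to_sets[OF X p, of "1 / 3"] by auto
  define \<psi> where "\<psi> = CApply (\<lambda>r. max 0 (min 1 (3 * r 0 - 1))) [CNorm p]"
  have "\<psi> \<in> all_formulas (continuous_functions X)"
    using p by (auto simp: \<psi>_def all_formulas_def
        intro!: continuous_intros continuous_map_Euclidean_space_coordinate)
  moreover have "cformula_val (continuous_functions X) a \<psi> =
      of_bool (\<not> bformula_holds (clopen_algebra X) U (BEq s t))" if close: "close_to_sets X \<delta> a U" for a U
  proof -
    let ?norm = "anorm (continuous_functions X) (poly_val (continuous_functions X) a p)"
    let ?s = "bterm_val (clopen_algebra X) U s" and ?t = "bterm_val (clopen_algebra X) U t"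
    have val: "poly_at (\<lambda>k. char_fun X (U k)) x p = of_bool (x \<in> ?s) - of_bool (x \<in> ?t)"
      if "x \<in> topspace X" for x
      using that by (simp add: p_def poly_of_bterm_char_fun)
    show ?thesis
    proof (cases "?s = ?t")
      case True
      then have "?norm \<le> 1 / 3"
        using \<delta>(2)[OF close] val by (intro anorm_poly_val_leI X) fastforce
      then show ?thesis using True by (simp add: \<psi>_def)
    next
      case False
      have "?s \<subseteq> topspace X" "?t \<subseteq> topspace X"
        using close BEq.prems by (auto intro!: clopen_subset bterm_val_clopen simp: close_to_sets_def)
      then obtain x where x: "x \<in> topspace X" "x \<in> ?s \<longleftrightarrow> x \<notin> ?t"
        using False by blast
      then have "cmod (poly_at (\<lambda>k. char_fun X (U k)) x p) = 1"
        by (simp add: val)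
      then have "2 / 3 \<le> cmod (poly_at a x p)"
        using \<delta>(2)[OF close x(1)] norm_triangle_ineq2[of "poly_at (\<lambda>k. char_fun X (U k)) x p" "poly_at a x p"]
        by (simp add: norm_minus_commute)
      also have "\<dots> \<le> ?norm"
        using close p by (intro cmod_poly_at_le_anorm X x) (auto simp: close_to_sets_def)
      finally show ?thesis using False by (simp add: \<psi>_def)
    qed
  qed
  ultimately show ?case using \<delta>(1) by blast
next
  case (BNot \<phi>)
  then obtain \<psi> \<delta> where \<psi>: "\<psi> \<in> all_formulas (continuous_functions X)" "\<delta> > 0"
    "\<And>a U. close_to_sets X \<delta> a U \<Longrightarrow>
      cformula_val (continuous_functions X) a \<psi> = of_bool (\<not> bformula_holds (clopen_algebra X) U \<phi>)"
    by auto
  show ?case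
    using \<psi> by (intro bexI[of _ "CApply (\<lambda>r. 1 - r 0) [\<psi>]"] exI[of _ \<delta>])
      (auto simp: all_formulas_def intro!: continuous_intros continuous_map_Euclidean_space_coordinate)
next
  case (BAnd \<phi> \<phi>')
  then obtain \<psi> \<delta> \<psi>' \<delta>' where \<psi>: "\<psi> \<in> all_formulas (continuous_functions X)" "\<delta> > 0"
    "\<And>a U. close_to_sets X \<delta> a U \<Longrightarrow>
      cformula_val (continuous_functions X) a \<psi> = of_bool (\<not> bformula_holds (clopen_algebra X) U \<phi>)"
    and \<psi>': "\<psi>' \<in> all_formulas (continuous_functions X)" "\<delta>' > 0"
    "\<And>a U. close_to_sets X \<delta>' a U \<Longrightarrow>
      cformula_val (continuous_functions X) a \<psi>' = of_bool (\<not> bformula_holds (clopen_algebra X) U \<phi>')"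
    by auto
  have "cformula_val (continuous_functions X) a (CApply (\<lambda>r. max (r 0) (r 1)) [\<psi>, \<psi>']) =
      of_bool (\<not> bformula_holds (clopen_algebra X) U (BAnd \<phi> \<phi>'))"
    if "close_to_sets X (min \<delta> \<delta>') a U" for a U
  proof -
    have "close_to_sets X \<delta> a U" "close_to_sets X \<delta>' a U"
      using that by (auto simp: close_to_sets_def)
    then show ?thesis
      using \<psi>(3)[of a U] \<psi>'(3)[of a U] by simp
  qed
  then show ?case
    using \<psi>(1,2) \<psi>'(1,2) by (intro bexI[of _ "CApply (\<lambda>r. max (r 0) (r 1)) [\<psi>, \<psi>']"] exI[of _ "min \<delta> \<delta>'"])
      (auto simp: all_formulas_def intro!: continuous_intros continuous_map_Euclidean_space_coordinate)
next
  case (BEx k \<phi>)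
  then obtain \<psi> \<delta> where \<psi>: "\<psi> \<in> all_formulas (continuous_functions X)" "\<delta> > 0"
    "\<And>a U. close_to_sets X \<delta> a U \<Longrightarrow>
      cformula_val (continuous_functions X) a \<psi> = of_bool (\<not> bformula_holds (clopen_algebra X) U \<phi>)"
    by auto
  define \<eta> where "\<eta> = min \<delta> (1 / 2)"
  have \<eta>: "0 < \<eta>" "\<eta> \<le> 1 / 2" "\<eta> \<le> \<delta>"
    using \<psi>(2) by (auto simp: \<eta>_def)
  \<comment> \<open>The second argument is the penalty: it is at least 1 unless the witness is \<open>\<eta>\<close>-close to a
      characteristic function.\<close>
  define \<theta> where "\<theta> = CApply (\<lambda>r. max (r 0) (r 1 / \<eta>\<^sup>2)) [\<psi>, CNorm (idempotence_defect k)]"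
  define \<psi>' where "\<psi>' = CApply (\<lambda>r. min 1 (r 0)) [CInf k \<theta>]"
  have "\<psi>' \<in> all_formulas (continuous_functions X)"
    using \<psi>(1) \<eta> by (auto simp: \<psi>'_def \<theta>_def all_formulas_def
        intro!: continuous_intros continuous_map_Euclidean_space_coordinate)
  moreover have "cformula_val (continuous_functions X) a \<psi>' =
      of_bool (\<not> bformula_holds (clopen_algebra X) U (BEx k \<phi>))" if close: "close_to_sets X \<eta> a U" for a U
  proof -
    let ?B = "unit_ball (continuous_functions X)"
    let ?defect = "\<lambda>c. anorm (continuous_functions X) (poly_val (continuous_functions X) (a(k := c)) (idempotence_defect k))"
    have val: "cformula_val (continuous_functions X) (a(k := c)) \<theta> =
        max (cformula_val (continuous_functions X) (a(k := c)) \<psi>) (?defect c / \<eta>\<^sup>2)" for c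
      by (simp add: \<theta>_def)
    have ball: "(a(k := c)) j \<in> ?B" if "c \<in> ?B" for c j
      using close that by (auto simp: close_to_sets_def)
    have nonneg: "0 \<le> ?defect c" if "c \<in> ?B" for c
    proof -
      obtain x where "x \<in> topspace X" using X by blast
      from cmod_poly_at_le_anorm[OF X(1) this, of "a(k := c)" "idempotence_defect k"] ball[OF that]
      show ?thesis by (simp add: order_trans[OF norm_ge_zero])
    qed
    have bdd: "bdd_below ((\<lambda>c. cformula_val (continuous_functions X) (a(k := c)) \<theta>) ` ?B)"
      using nonneg by (intro bdd_belowI2[where m = 0]) (auto simp: val le_max_iff_disj)
    have ne: "?B \<noteq> {}"
      using char_fun_in_unit_ball[OF X, of "{}"] by (auto simp: clopen_def)
    have closeI: "close_to_sets X \<delta> (a(k := c)) (U(k := V))"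
      if "c \<in> ?B" "clopen X V" "\<And>x. x \<in> topspace X \<Longrightarrow> cmod (c x - char_fun X V x) < \<delta>" for c V
      unfolding close_to_sets_def
    proof (intro allI)
      fix j
      have "cmod (a j x - char_fun X (U j) x) < \<delta>" if "x \<in> topspace X" for x
        using close that \<eta>(3) by (auto simp: close_to_sets_def intro: less_le_trans)
      then show "(a(k := c)) j \<in> ?B \<and> clopen X ((U(k := V)) j) \<and>
          (\<forall>x\<in>topspace X. cmod ((a(k := c)) j x - char_fun X ((U(k := V)) j) x) < \<delta>)"
        using close that by (simp add: close_to_sets_def)
    qed
    show ?thesis
    proof (cases "\<exists>V. clopen X V \<and> bformula_holds (clopen_algebra X) (U(k := V)) \<phi>")
      case True
      then obtain V where V: "clopen X V" "bformula_holds (clopen_algebra X) (U(k := V)) \<phi>" by blast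
      let ?c = "char_fun X V"
      have "?defect ?c \<le> 0"
        by (rule anorm_poly_val_leI[OF X(2)]) (simp add: char_fun_def)
      moreover have "cformula_val (continuous_functions X) (a(k := ?c)) \<psi> = 0"
        using V \<psi>(2) by (subst \<psi>(3)[of _ "U(k := V)"]) (auto intro!: closeI char_fun_in_unit_ball X)
      ultimately have "cformula_val (continuous_functions X) (a(k := ?c)) \<theta> \<le> 0"
        using \<eta> by (simp add: val divide_le_0_iff)
      then have "cformula_val (continuous_functions X) a (CInf k \<theta>) \<le> 0"
        using cINF_lower[OF bdd char_fun_in_unit_ball[OF X V(1)]] by simp
      moreover have "cformula_val (continuous_functions X) a (CInf k \<theta>) \<ge> 0"
        using nonneg ne by (auto intro!: cINF_greatest simp: val le_max_iff_disj)
      ultimately show ?thesis using True by (simp add: \<psi>'_def)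
    next
      case False
      have "1 \<le> cformula_val (continuous_functions X) (a(k := c)) \<theta>" if c: "c \<in> ?B" for c
      proof (cases "?defect c < \<eta>\<^sup>2")
        case True
        from almost_idempotent_close_to_char_fun[OF X ball[OF c] \<eta>(1,2) True]
        obtain V where V: "clopen X V" "\<And>x. x \<in> topspace X \<Longrightarrow> cmod (c x - char_fun X V x) < \<eta>"
          by auto
        have "close_to_sets X \<delta> (a(k := c)) (U(k := V))"
          using V(2) \<eta>(3) by (intro closeI c V(1)) (auto intro: less_le_trans)
        from \<psi>(3)[OF this] show ?thesis
          using False V(1) by (simp add: val)
      next
        case 2: False
        then show ?thesis
          using \<eta>(1) by (simp add: val le_max_iff_disj)
      qed
      then have "1 \<le> cformula_val (continuous_functions X) a (CInf k \<theta>)"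
        using ne by (auto intro!: cINF_greatest)
      then show ?thesis using False by (simp add: \<psi>'_def)
    qed
  qed
  ultimately show ?case using \<eta>(1) by blast
qed

section \<open>Expanding functions in clopen digits\<close>

text \<open>The ratio \<open>2 / 3\<close> exceeds \<open>1 / 2\<close>, so expansions are redundant. Binary digits of a continuous
  function need not be clopen, because the first one would have to separate \<open>{f < 1 / 2}\<close> from
  \<open>{f > 1 / 2}\<close>. Here the first digit only has to be 1 where \<open>f > 2 / 3\<close> and 0 where \<open>f < 1 / 3\<close>.\<close>

definition digit_sum :: "(nat \<Rightarrow> bool) \<Rightarrow> real" where
  "digit_sum d = (\<Sum>i. of_bool (d i) / 3 * (2 / 3) ^ i)"

lemma summable_digits: "summable (\<lambda>i. of_bool (d i) / 3 * (2 / 3 :: real) ^ i)"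
  by (rule summable_comparison_test'[of "\<lambda>i. (2 / 3) ^ i" 0]) (auto simp: summable_geometric)

lemma digit_sum_bounds: "0 \<le> digit_sum d" "digit_sum d \<le> 1"
proof -
  show "0 \<le> digit_sum d"
    unfolding digit_sum_def by (intro suminf_nonneg summable_digits) auto
  have "digit_sum d \<le> (\<Sum>i. 1 / 3 * (2 / 3) ^ i)"
    unfolding digit_sum_def
    by (intro suminf_le summable_digits summable_mult summable_geometric) auto
  also have "\<dots> = 1"
    by (subst suminf_mult) (auto simp: suminf_geometric summable_geometric)
  finally show "digit_sum d \<le> 1" .
qed

lemma digit_sum_unfold: "digit_sum d = of_bool (d 0) / 3 + 2 / 3 * digit_sum (\<lambda>i. d (Suc i))"
proof -
  have "digit_sum d = (\<Sum>i. of_bool (d (Suc i)) / 3 * (2 / 3) ^ Suc i) + of_bool (d 0) / 3"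
    unfolding digit_sum_def using suminf_split_head[OF summable_digits[of d]] by simp
  also have "(\<Sum>i. of_bool (d (Suc i)) / 3 * (2 / 3 :: real) ^ Suc i) = 2 / 3 * digit_sum (\<lambda>i. d (Suc i))"
    unfolding digit_sum_def using suminf_mult[OF summable_digits[of "\<lambda>i. d (Suc i)"], of "2 / 3"]
    by (simp add: algebra_simps)
  finally show ?thesis by simp
qed

text \<open>The sequence \<open>f\<close> consists of the successive remainders of \<open>f 0\<close>. It covers both the remainders of
  a function under expansion and the tails of another digit sum.\<close>

lemma abs_diff_digit_sum_le:
  assumes "\<And>i. i < n \<Longrightarrow> f i = of_bool (d i) / 3 + 2 / 3 * f (Suc i)" and "0 \<le> f n" "f n \<le> 1"
  shows "\<bar>f 0 - digit_sum d\<bar> \<le> (2 / 3) ^ n"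
  using assms
proof (induction n arbitrary: f d)
  case 0
  then show ?case
    using digit_sum_bounds[of d] by auto
next
  case (Suc n)
  have "\<bar>f (Suc 0) - digit_sum (\<lambda>i. d (Suc i))\<bar> \<le> (2 / 3) ^ n"
    using Suc.prems by (intro Suc.IH[of "\<lambda>i. f (Suc i)"]) auto
  moreover have "f 0 - digit_sum d = 2 / 3 * (f (Suc 0) - digit_sum (\<lambda>i. d (Suc i)))"
    using Suc.prems(1)[of 0] digit_sum_unfold[of d] by simp
  ultimately show ?case
    unfolding \<open>f 0 - digit_sum d = _\<close> by (simp add: abs_mult)
qed

lemma digit_sum_close:
  assumes "\<And>i. i < n \<Longrightarrow> d i = d' i"
  shows "\<bar>digit_sum d - digit_sum d'\<bar> \<le> (2 / 3) ^ n"
proof -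
  define f where "f i = digit_sum (\<lambda>j. d (i + j))" for i
  have "f i = of_bool (d' i) / 3 + 2 / 3 * f (Suc i)" if "i < n" for i
    using assms[OF that] digit_sum_unfold[of "\<lambda>j. d (i + j)"] by (simp add: f_def)
  from abs_diff_digit_sum_le[of n f d', OF this] show ?thesis
    by (simp add: f_def digit_sum_bounds)
qed

lemma clopen_between:
  assumes "compact_space X" "zero_dimensional X" "closedin X C" "openin X G" "C \<subseteq> G"
  shows "\<exists>U. clopen X U \<and> C \<subseteq> U \<and> U \<subseteq> G"
proof -
  obtain \<B> where \<B>: "\<And>U. U \<in> \<B> \<Longrightarrow> clopen X U" "openin X = arbitrary union_of (\<lambda>U. U \<in> \<B>)"
    using assms(2) unfolding zero_dimensional_def clopen_def by blast
  obtain \<U> where \<U>: "\<U> \<subseteq> \<B>" "\<Union>\<U> = G"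
    using assms(4) unfolding \<B>(2) by (auto simp: union_of_def arbitrary_def)
  have "compactin X C"
    using assms(1,3) closedin_compact_space by blast
  then obtain \<F> where "finite \<F>" "\<F> \<subseteq> \<U>" "C \<subseteq> \<Union>\<F>"
    using assms(5) \<U> \<B>(1) unfolding compactin_def clopen_def by (metis subsetD)
  moreover from this have "clopen X (\<Union>\<F>)"
    using \<U>(1) \<B>(1) unfolding clopen_def by (auto intro!: openin_Union closedin_Union)
  ultimately show ?thesis
    using \<U>(2) by blast
qed

text \<open>The greedy algorithm with a clopen choice: a clopen \<open>U\<close> with
  \<open>{g \<ge> 2 / 3} \<subseteq> U \<subseteq> {g > 1 / 3}\<close> makes the rescaled remainder
  \<open>(3 / 2) (g - 1\<^sub>U / 3)\<close> take values in \<open>[0, 1]\<close> again.\<close>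

lemma continuous_real_digit_expansion:
  assumes X: "compact_space X" "zero_dimensional X"
    and f: "continuous_map X euclideanreal f" "\<And>x. x \<in> topspace X \<Longrightarrow> 0 \<le> f x \<and> f x \<le> 1"
  shows "\<exists>U. (\<forall>i. clopen X (U i)) \<and> (\<forall>x\<in>topspace X. f x = digit_sum (\<lambda>i. x \<in> U i))"
proof -
  define good where "good g \<longleftrightarrow> continuous_map X euclideanreal g \<and> (\<forall>x\<in>topspace X. 0 \<le> g x \<and> g x \<le> 1)" for g
  have step: "\<exists>U. clopen X U \<and> good (\<lambda>x. 3 / 2 * (g x - of_bool (x \<in> U) / 3))" if g: "good g" for g
  proof -
    have "closedin X {x \<in> topspace X. g x \<in> {2 / 3..}}"
      using g unfolding good_def by (intro closedin_continuous_map_preimage[of X euclideanreal]) auto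
    moreover have "openin X {x \<in> topspace X. g x \<in> {1 / 3<..}}"
      using g unfolding good_def by (intro openin_continuous_map_preimage[of X euclideanreal]) auto
    ultimately obtain U where U: "clopen X U"
      "{x \<in> topspace X. g x \<in> {2 / 3..}} \<subseteq> U" "U \<subseteq> {x \<in> topspace X. g x \<in> {1 / 3<..}}"
      using clopen_between[OF X, of "{x \<in> topspace X. g x \<in> {2 / 3..}}" "{x \<in> topspace X. g x \<in> {1 / 3<..}}"]
      by fastforce
    have "0 \<le> 3 / 2 * (g x - of_bool (x \<in> U) / 3) \<and> 3 / 2 * (g x - of_bool (x \<in> U) / 3) \<le> 1"
      if "x \<in> topspace X" for x
      using g that U(2,3) by (cases "x \<in> U") (force simp: good_def)+
    moreover have "continuous_map X euclideanreal (\<lambda>x. 3 / 2 * (g x - of_bool (x \<in> U) / 3))"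
      using g unfolding good_def
      by (intro continuous_intros continuous_map_of_bool_clopen U(1)) auto
    ultimately show ?thesis
      using U(1) unfolding good_def by blast
  qed
  then obtain S where S: "\<And>g. good g \<Longrightarrow> clopen X (S g)"
    "\<And>g. good g \<Longrightarrow> good (\<lambda>x. 3 / 2 * (g x - of_bool (x \<in> S g) / 3))"
    by metis
  define F where "F = rec_nat f (\<lambda>_ g x. 3 / 2 * (g x - of_bool (x \<in> S g) / 3))"
  define U where "U n = S (F n)" for n
  have F: "F 0 = f" "F (Suc n) = (\<lambda>x. 3 / 2 * (F n x - of_bool (x \<in> U n) / 3))" for n
    by (simp_all add: F_def U_def)
  have good: "good (F n)" for n
    by (induction n) (use f in \<open>simp_all add: F(1) good_def\<close>, use S(2) in \<open>simp add: F(2) U_def good_def\<close>)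
  have "f x = digit_sum (\<lambda>i. x \<in> U i)" if x: "x \<in> topspace X" for x
  proof -
    have "F i x = of_bool (x \<in> U i) / 3 + 2 / 3 * F (Suc i) x" for i
      by (simp add: F(2) field_simps)
    moreover have "0 \<le> F n x" "F n x \<le> 1" for n
      using good[of n] x by (auto simp: good_def)
    ultimately have "\<bar>F 0 x - digit_sum (\<lambda>i. x \<in> U i)\<bar> \<le> (2 / 3) ^ n" for n
      using abs_diff_digit_sum_le[of n "\<lambda>i. F i x" "\<lambda>i. x \<in> U i"] by blast
    then have "\<bar>F 0 x - digit_sum (\<lambda>i. x \<in> U i)\<bar> \<le> 0"
      by (intro LIMSEQ_le_const[OF LIMSEQ_realpow_zero[of "2 / 3"]]) auto
    then show ?thesis by (simp add: F(1))
  qed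
  moreover have "clopen X (U i)" for i
    using S(1) good by (simp add: U_def)
  ultimately show ?thesis by blast
qed

text \<open>Even digits give the real part and odd digits the imaginary part, both rescaled to \<open>[-1, 1]\<close>.
  The values fill a square, so a digit sequence need not describe an element of the unit ball.\<close>

definition complex_of_digits :: "(nat \<Rightarrow> bool) \<Rightarrow> complex" where
  "complex_of_digits d =
    Complex (2 * digit_sum (\<lambda>i. d (2 * i)) - 1) (2 * digit_sum (\<lambda>i. d (2 * i + 1)) - 1)"

lemma complex_of_digits_close:
  assumes "\<epsilon> > 0"
  shows "\<exists>n. \<forall>d d'. (\<forall>i<n. d i = d' i) \<longrightarrow> cmod (complex_of_digits d - complex_of_digits d') < \<epsilon>"
proof -
  obtain n where n: "(2 / 3) ^ n < \<epsilon> / 4"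
    using real_arch_pow_inv[of "\<epsilon> / 4" "2 / 3"] assms by auto
  have "cmod (complex_of_digits d - complex_of_digits d') < \<epsilon>" if "\<forall>i<2 * n. d i = d' i" for d d'
  proof -
    have "\<bar>digit_sum (\<lambda>i. d (2 * i)) - digit_sum (\<lambda>i. d' (2 * i))\<bar> \<le> (2 / 3) ^ n"
      "\<bar>digit_sum (\<lambda>i. d (2 * i + 1)) - digit_sum (\<lambda>i. d' (2 * i + 1))\<bar> \<le> (2 / 3) ^ n"
      using that by (auto intro!: digit_sum_close)
    then show ?thesis
      using n cmod_le[of "complex_of_digits d - complex_of_digits d'"]
      by (simp add: complex_of_digits_def)
  qed
  then show ?thesis by blast
qed

definition function_of_digits :: "'x topology \<Rightarrow> (nat \<Rightarrow> 'x set) \<Rightarrow> 'x \<Rightarrow> complex" where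
  "function_of_digits X V = (\<lambda>x\<in>topspace X. complex_of_digits (\<lambda>i. x \<in> V i))"

lemma continuous_map_function_of_digits:
  assumes "\<And>i. clopen X (V i)"
  shows "continuous_map X euclidean (function_of_digits X V)"
proof (rule continuous_map_euclideanI)
  fix x and \<epsilon> :: real assume x: "x \<in> topspace X" and "\<epsilon> > 0"
  then obtain n where n: "\<And>d d'. (\<forall>i<n. d i = d' i) \<Longrightarrow> cmod (complex_of_digits d - complex_of_digits d') < \<epsilon>"
    using complex_of_digits_close by metis
  define G where "G = topspace X \<inter> (\<Inter>i<n. if x \<in> V i then V i else topspace X - V i)"
  have "openin X (if x \<in> V i then V i else topspace X - V i)" for i
    using assms[of i] by (auto simp: clopen_def)
  then have "openin X G"
    unfolding G_def by (cases "n = 0") (simp, intro openin_Int openin_topspace openin_INT2, auto)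
  moreover have "dist (function_of_digits X V x) (function_of_digits X V y) < \<epsilon>" if "y \<in> G" for y
  proof -
    have "\<forall>i<n. (x \<in> V i) = (y \<in> V i)" "y \<in> topspace X"
      using that by (auto simp: G_def split: if_splits)
    then show ?thesis
      using x n[of "\<lambda>i. x \<in> V i" "\<lambda>i. y \<in> V i"] by (simp add: function_of_digits_def dist_norm)
  qed
  ultimately show "\<exists>G. openin X G \<and> x \<in> G \<and>
      (\<forall>y\<in>G. dist (function_of_digits X V x) (function_of_digits X V y) < \<epsilon>)"
    using x by (intro exI[of _ G]) (auto simp: G_def)
qed

lemma unit_ball_digit_expansion:
  assumes X: "compact_space X" "topspace X \<noteq> {}" "zero_dimensional X"
    and f: "f \<in> unit_ball (continuous_functions X)"
  shows "\<exists>V. (\<forall>i. clopen X (V i)) \<and> f = function_of_digits X V"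
proof -
  have f': "continuous_map X euclidean f" "f \<in> extensional (topspace X)" "\<And>x. x \<in> topspace X \<Longrightarrow> cmod (f x) \<le> 1"
    using f unit_ball_continuous_functions[OF X(1,2)] by auto
  have expand: "\<exists>U. (\<forall>i. clopen X (U i)) \<and> (\<forall>x\<in>topspace X. (h (f x) + 1) / 2 = digit_sum (\<lambda>i. x \<in> U i))"
    if h: "continuous_on UNIV h" "\<And>z. \<bar>h z\<bar> \<le> cmod z" for h :: "complex \<Rightarrow> real"
  proof (rule continuous_real_digit_expansion[OF X(1,3)])
    have "continuous_map X euclideanreal (h \<circ> f)"
      using h(1) by (intro continuous_map_compose[OF f'(1)]) simp
    then show "continuous_map X euclideanreal (\<lambda>x. (h (f x) + 1) / 2)"
      by (intro continuous_intros) (auto simp: o_def)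
    show "0 \<le> (h (f x) + 1) / 2 \<and> (h (f x) + 1) / 2 \<le> 1" if "x \<in> topspace X" for x
      using h(2)[of "f x"] f'(3)[OF that] by auto
  qed
  obtain U where U: "\<And>i. clopen X (U i)"
      "\<And>x. x \<in> topspace X \<Longrightarrow> (Re (f x) + 1) / 2 = digit_sum (\<lambda>i. x \<in> U i)"
    using expand[OF continuous_on_Re[OF continuous_on_id] abs_Re_le_cmod] by blast
  obtain U' where U': "\<And>i. clopen X (U' i)"
      "\<And>x. x \<in> topspace X \<Longrightarrow> (Im (f x) + 1) / 2 = digit_sum (\<lambda>i. x \<in> U' i)"
    using expand[OF continuous_on_Im[OF continuous_on_id] abs_Im_le_cmod] by blast
  define V where "V j = (if even j then U (j div 2) else U' (j div 2))" for j
  have "f x = function_of_digits X V x" if "x \<in> topspace X" for x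
    using that by (simp add: function_of_digits_def complex_of_digits_def V_def complex_eq_iff
        field_simps flip: U(2) U'(2))
  then have "f = function_of_digits X V"
    by (intro extensionalityI[OF f'(2)]) (auto simp: function_of_digits_def)
  then show ?thesis
    using U(1) U'(1) by (intro exI[of _ V]) (auto simp: V_def)
qed

section \<open>Realizing a pattern of cells\<close>

text \<open>Sequential compactness of the Cantor space, by halving an infinite set of indices repeatedly.\<close>

lemma infinitely_often_prefix:
  fixes e :: "nat \<Rightarrow> nat \<Rightarrow> bool"
  shows "\<exists>p. \<forall>n m. \<exists>N\<ge>m. \<forall>i<n. e N i = p i"
proof -
  define I where "I = rec_nat UNIV (\<lambda>i S. if infinite {N \<in> S. e N i} then {N \<in> S. e N i} else {N \<in> S. \<not> e N i})"
  define p where "p i = infinite {N \<in> I i. e N i}" for i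
  have I: "I 0 = UNIV" "I (Suc i) = (if p i then {N \<in> I i. e N i} else {N \<in> I i. \<not> e N i})" for i
    by (simp_all add: I_def p_def)
  have inf: "infinite (I i)" for i
  proof (induction i)
    case 0
    then show ?case by (simp add: I)
  next
    case (Suc i)
    have "I i = {N \<in> I i. e N i} \<union> {N \<in> I i. \<not> e N i}" by blast
    with Suc have "infinite {N \<in> I i. e N i} \<or> infinite {N \<in> I i. \<not> e N i}"
      by (metis (no_types, lifting) finite_UnI)
    then show ?case
      by (auto simp: I p_def)
  qed
  have "\<forall>i<n. e N i = p i" if "N \<in> I n" for n N
    using that by (induction n) (auto simp: I less_Suc_eq split: if_splits)
  moreover have "\<exists>N\<ge>m. N \<in> I n" for n m
    using inf[of n] by (meson infinite_nat_iff_unbounded_le)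
  ultimately show ?thesis by metis
qed

text \<open>The cell prescribed by \<open>\<sigma>\<close> consists of the points whose membership in \<open>\<tau> 0\<close>, \<open>\<tau> 1\<close>, \<open>\<dots>\<close> is given
  by the entries of \<open>\<sigma>\<close>.\<close>

primrec cell_term :: "(nat \<Rightarrow> 'b bterm) \<Rightarrow> bool list \<Rightarrow> 'b bterm" where
  "cell_term \<tau> [] = BOne"
| "cell_term \<tau> (s # \<sigma>) = BMeet (if s then \<tau> 0 else BCompl (\<tau> 0)) (cell_term (\<lambda>i. \<tau> (Suc i)) \<sigma>)"

lemma cell_term_val:
  "bterm_val (clopen_algebra X) v (cell_term \<tau> \<sigma>) =
    {x \<in> topspace X. \<forall>i<length \<sigma>. (x \<in> bterm_val (clopen_algebra X) v (\<tau> i)) = \<sigma> ! i}"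
proof (induction \<sigma> arbitrary: \<tau>)
  case Nil
  then show ?case by simp
next
  case (Cons s \<sigma>)
  have "bterm_val (clopen_algebra X) v (cell_term \<tau> (s # \<sigma>)) =
      {x \<in> topspace X. (x \<in> bterm_val (clopen_algebra X) v (\<tau> 0)) = s} \<inter>
      bterm_val (clopen_algebra X) v (cell_term (\<lambda>i. \<tau> (Suc i)) \<sigma>)"
    unfolding cell_term.simps bterm_val.simps Cons.IH by auto
  then show ?case
    unfolding Cons.IH by (auto simp: All_less_Suc2)
qed

lemma set_cell_term: "set_bterm (cell_term \<tau> \<sigma>) \<subseteq> (\<Union>i. set_bterm (\<tau> i))"
proof (induction \<sigma> arbitrary: \<tau>)
  case (Cons s \<sigma>)
  then show ?case using Cons.IH[of "\<lambda>i. \<tau> (Suc i)"] by (cases s) (auto; blast)+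
qed simp

text \<open>Digits of the variables (Boolean variables) and of the parameters (Boolean parameters) are
  interleaved, so that one list of truth values describes a cell.\<close>

definition digit_terms :: "(nat \<Rightarrow> 'b) \<Rightarrow> nat \<Rightarrow> 'b bterm" where
  "digit_terms W c = (if even c then BVar (c div 2) else BParam (W (c div 2)))"

definition same_digits ::
    "nat \<Rightarrow> (nat \<Rightarrow> 'x set) \<Rightarrow> (nat \<Rightarrow> 'x set) \<Rightarrow> (nat \<Rightarrow> 'x set) \<Rightarrow> 'x \<Rightarrow> 'x \<Rightarrow> bool" where
  "same_digits m W V V' x y \<longleftrightarrow> (\<forall>c<m. (x \<in> V c \<longleftrightarrow> y \<in> V' c) \<and> (x \<in> W c \<longleftrightarrow> y \<in> W c))"

text \<open>Given \<open>x\<close>, apply the hypothesis to the cell of \<open>x\<close>. Length \<open>2 * m\<close> accounts for \<open>m\<close> digits of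
  the variables and \<open>m\<close> of the parameters.\<close>

lemma same_digits_via_cells:
  assumes "\<And>\<sigma>. length \<sigma> = 2 * m \<Longrightarrow>
      bterm_val (clopen_algebra X) V (cell_term (digit_terms W) \<sigma>) \<noteq> {} \<Longrightarrow>
      bterm_val (clopen_algebra X) V' (cell_term (digit_terms W) \<sigma>) \<noteq> {}"
    and x: "x \<in> topspace X"
  shows "\<exists>y\<in>topspace X. same_digits m W V V' x y"
proof -
  define \<sigma> where "\<sigma> = map (\<lambda>i. x \<in> bterm_val (clopen_algebra X) V (digit_terms W i)) [0..<2 * m]"
  have "x \<in> bterm_val (clopen_algebra X) V (cell_term (digit_terms W) \<sigma>)"
    using x by (simp add: cell_term_val \<sigma>_def)
  then obtain y where y: "y \<in> bterm_val (clopen_algebra X) V' (cell_term (digit_terms W) \<sigma>)"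
    using assms(1)[of \<sigma>] by (auto simp: \<sigma>_def)
  then have *: "(y \<in> bterm_val (clopen_algebra X) V' (digit_terms W i)) =
      (x \<in> bterm_val (clopen_algebra X) V (digit_terms W i))" if "i < 2 * m" for i
    using that by (simp add: cell_term_val \<sigma>_def)
  have "same_digits m W V V' x y"
    unfolding same_digits_def
  proof (intro allI impI conjI)
    fix c assume "c < m"
    then show "x \<in> V c \<longleftrightarrow> y \<in> V' c" "x \<in> W c \<longleftrightarrow> y \<in> W c"
      using *[of "2 * c"] *[of "2 * c + 1"] by (simp_all add: digit_terms_def)
  qed
  then show ?thesis
    using y by (auto simp: cell_term_val)
qed

definition matched :: "'x topology \<Rightarrow> (nat \<Rightarrow> 'x \<Rightarrow> 'x \<Rightarrow> bool) \<Rightarrow> bool" where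
  "matched X R \<longleftrightarrow> (\<forall>m. (\<forall>x\<in>topspace X. \<exists>y\<in>topspace X. R m x y) \<and> (\<forall>y\<in>topspace X. \<exists>x\<in>topspace X. R m x y))"

text \<open>The type says for every cell whether it is empty, following the pattern that occurs for
  infinitely many \<open>N\<close>. Its realization \<open>v\<close> has, for each \<open>m\<close>, the same nonempty cells of length
  \<open>2 m\<close> as some \<open>V N\<close> with \<open>N \<ge> m\<close>, so points of corresponding cells can be matched.\<close>

lemma realize_digit_patterns:
  assumes sat: "countably_saturated_ba (clopen_algebra X)"
    and V: "\<And>N c. clopen X (V N c)" and W: "\<And>c. clopen X (W c)"
  shows "\<exists>v r. (\<forall>c. clopen X (v c)) \<and> (\<forall>m. m \<le> r m) \<and>
      matched X (\<lambda>m. same_digits m W v (V (r m)))"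
proof -
  let ?B = "clopen_algebra X"
  let ?cell = "\<lambda>\<sigma>. cell_term (digit_terms W) \<sigma>"
  define e where "e N j \<longleftrightarrow> bterm_val ?B (V N) (?cell (from_nat j)) \<noteq> {}" for N j
  obtain p where p: "\<And>n m. \<exists>N\<ge>m. \<forall>i<n. e N i = p i"
    using infinitely_often_prefix[of e] by blast
  define \<phi> where "\<phi> \<sigma> = (if p (to_nat \<sigma>) then BNot (BEq (?cell \<sigma>) BZero) else BEq (?cell \<sigma>) BZero)" for \<sigma>
  have \<phi>: "bformula_holds ?B v (\<phi> \<sigma>) \<longleftrightarrow> (bterm_val ?B v (?cell \<sigma>) \<noteq> {}) = p (to_nat \<sigma>)" for v \<sigma>
    by (simp add: \<phi>_def clopen_algebra_def)
  \<comment> \<open>Any finite part of the pattern is the true one for arbitrarily large \<open>N\<close>.\<close>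
  have prefix: "\<exists>N\<ge>m. \<forall>\<sigma>\<in>S. (bterm_val ?B (V N) (?cell \<sigma>) \<noteq> {}) = p (to_nat \<sigma>)"
    if "finite S" for S m
  proof -
    obtain N where N: "N \<ge> m" "\<And>i. i < Suc (Max (to_nat ` S)) \<Longrightarrow> e N i = p i"
      using p by metis
    have "to_nat \<sigma> < Suc (Max (to_nat ` S))" if "\<sigma> \<in> S" for \<sigma>
      using that \<open>finite S\<close> by (simp add: less_Suc_eq_le)
    with N show ?thesis
      by (intro exI[of _ N]) (metis e_def from_nat_to_nat)
  qed
  have "countable (range \<phi>)" by simp
  moreover have "set_bformula (\<phi> \<sigma>) \<subseteq> carrier ?B" for \<sigma>
  proof -
    have "set_bformula (\<phi> \<sigma>) \<subseteq> set_bterm (?cell \<sigma>)" by (simp add: \<phi>_def)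
    also have "\<dots> \<subseteq> carrier ?B"
      using set_cell_term[of "digit_terms W" \<sigma>] W by (fastforce simp: digit_terms_def split: if_splits)
    finally show ?thesis .
  qed
  moreover have "\<exists>v. (\<forall>k. v k \<in> carrier ?B) \<and> (\<forall>\<psi>\<in>F. bformula_holds ?B v \<psi>)"
    if F: "finite F" "F \<subseteq> range \<phi>" for F
  proof -
    obtain S where S: "finite S" "F = \<phi> ` S"
      using finite_subset_image[OF F] by blast
    then show ?thesis
      using prefix[of S 0] V by (auto simp: \<phi>)
  qed
  ultimately obtain v where v: "\<And>k. v k \<in> carrier ?B" "\<And>\<sigma>. bformula_holds ?B v (\<phi> \<sigma>)"
    using sat[unfolded countably_saturated_ba_def, rule_format, of "range \<phi>"] by auto
  have "\<exists>N\<ge>m. \<forall>\<sigma>. length \<sigma> = 2 * m \<longrightarrow> (bterm_val ?B v (?cell \<sigma>) \<noteq> {}) = (bterm_val ?B (V N) (?cell \<sigma>) \<noteq> {})" for m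
  proof -
    have "finite {\<sigma> :: bool list. length \<sigma> = 2 * m}"
      using finite_lists_length_eq[of "UNIV :: bool set" "2 * m"] by simp
    from prefix[OF this, of m] obtain N where "N \<ge> m"
      "\<And>\<sigma>. length \<sigma> = 2 * m \<Longrightarrow> (bterm_val ?B (V N) (?cell \<sigma>) \<noteq> {}) = p (to_nat \<sigma>)"
      by auto
    then show ?thesis
      using v(2)[unfolded \<phi>] by (intro exI[of _ N]) blast
  qed
  then obtain r where r: "\<And>m. m \<le> r m" "\<And>m \<sigma>. length \<sigma> = 2 * m \<Longrightarrow>
      (bterm_val ?B v (?cell \<sigma>) \<noteq> {}) = (bterm_val ?B (V (r m)) (?cell \<sigma>) \<noteq> {})"
    by metis
  have "\<exists>y\<in>topspace X. same_digits m W v (V (r m)) x y" if "x \<in> topspace X" for x m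
    using same_digits_via_cells[OF _ that] r(2) by blast
  moreover have "\<exists>x\<in>topspace X. same_digits m W v (V (r m)) x y" if "y \<in> topspace X" for y m
  proof -
    have "\<exists>x\<in>topspace X. same_digits m W (V (r m)) v y x"
      using same_digits_via_cells[OF _ that] r(2) by blast
    then show ?thesis by (auto simp: same_digits_def)
  qed
  ultimately have "matched X (\<lambda>m. same_digits m W v (V (r m)))"
    unfolding matched_def by blast
  then show ?thesis
    using v(1) r(1) by auto
qed

section \<open>Convergence of quantifier-free values\<close>

text \<open>Convergence of \<open>g m\<close> to \<open>f\<close> along the matching of points of \<open>X\<close> given by \<open>R m\<close>, uniformly in the
  matched points. The functions themselves need not converge in \<open>C(X)\<close>.\<close>

definition asymptotically_equal ::
    "'x topology \<Rightarrow> (nat \<Rightarrow> 'x \<Rightarrow> 'x \<Rightarrow> bool) \<Rightarrow> ('x \<Rightarrow> complex) \<Rightarrow> (nat \<Rightarrow> 'x \<Rightarrow> complex) \<Rightarrow> bool" where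
  "asymptotically_equal X R f g \<longleftrightarrow>
    (\<forall>x y. (\<forall>m. x m \<in> topspace X \<and> y m \<in> topspace X \<and> R m (x m) (y m)) \<longrightarrow>
      (\<lambda>m. f (x m) - g m (y m)) \<longlonglongrightarrow> 0)"

text \<open>The values of the polynomial at matched points are uniformly close, and each point is matched from
  either side, so the two suprema are close.\<close>

lemma anorm_poly_val_tendsto:
  assumes X: "compact_space X" "topspace X \<noteq> {}" and R: "matched X R"
    and b: "\<And>k. b k \<in> unit_ball (continuous_functions X)" "\<And>m k. c m k \<in> unit_ball (continuous_functions X)"
      "\<And>k. asymptotically_equal X R (b k) (\<lambda>m. c m k)"
    and p: "set_star_poly p \<subseteq> unit_ball (continuous_functions X)"
      "\<And>f. f \<in> set_star_poly p \<Longrightarrow> asymptotically_equal X R f (\<lambda>m. f)"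
  shows "(\<lambda>m. anorm (continuous_functions X) (poly_val (continuous_functions X) (c m) p)) \<longlonglongrightarrow>
    anorm (continuous_functions X) (poly_val (continuous_functions X) b p)"
proof (rule tendstoI)
  let ?norm = "\<lambda>v. anorm (continuous_functions X) (poly_val (continuous_functions X) v p)"
  note ball = unit_ball_continuous_functions[OF X]
  fix \<epsilon> :: real assume "\<epsilon> > 0"
  define R' where "R' m x y \<longleftrightarrow> x \<in> topspace X \<and> y \<in> topspace X \<and> R m x y" for m x y
  have "\<forall>\<^sub>F m in sequentially. \<forall>x y. R' m x y \<longrightarrow> cmod (poly_at b x p - poly_at (c m) y p) < \<epsilon> / 2"
  proof (rule eventually_all_pairsI)
    show "\<exists>x y. R' m x y" for m
      using X(2) R by (fastforce simp: R'_def matched_def)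
  next
    fix x y assume "\<And>m. R' m (x m) (y m)"
    then have xy: "\<And>m. x m \<in> topspace X \<and> y m \<in> topspace X \<and> R m (x m) (y m)"
      by (simp add: R'_def)
    have "(\<lambda>m. poly_at b (x m) p - poly_at (c m) (y m) p) \<longlonglongrightarrow> 0"
    proof (rule pointwise_val_diff_tendsto_0)
      show "cmod (b k (x m)) \<le> 1" "cmod (c m k (y m)) \<le> 1" for k m
        using b(1,2) ball xy by auto
      show "cmod (f (x m)) \<le> 1" "cmod (f (y m)) \<le> 1" if "f \<in> set_star_poly p" for f m
        using p(1) that ball xy by auto
      show "(\<lambda>m. b k (x m) - c m k (y m)) \<longlonglongrightarrow> 0" for k
        using b(3) xy by (simp add: asymptotically_equal_def)
      show "(\<lambda>m. f (x m) - f (y m)) \<longlonglongrightarrow> 0" if "f \<in> set_star_poly p" for f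
        using p(2)[OF that] xy by (simp add: asymptotically_equal_def)
    qed
    then show "\<forall>\<^sub>F m in sequentially. cmod (poly_at b (x m) p - poly_at (c m) (y m) p) < \<epsilon> / 2"
      using \<open>\<epsilon> > 0\<close> by (auto dest!: tendstoD[of _ _ _ "\<epsilon> / 2"])
  qed
  then show "\<forall>\<^sub>F m in sequentially. dist (?norm (c m)) (?norm b) < \<epsilon>"
  proof (rule eventually_mono)
    fix m assume close: "\<forall>x y. R' m x y \<longrightarrow> cmod (poly_at b x p - poly_at (c m) y p) < \<epsilon> / 2"
    have "?norm b \<le> ?norm (c m) + \<epsilon> / 2"
    proof (rule anorm_poly_val_leI[OF X(2)])
      fix x assume x: "x \<in> topspace X"
      then obtain y where y: "y \<in> topspace X" "R' m x y"
        using R unfolding matched_def R'_def by blast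
      have "cmod (poly_at b x p) \<le> cmod (poly_at (c m) y p) + \<epsilon> / 2"
        using close[rule_format, OF y(2)] norm_triangle_ineq2[of "poly_at b x p" "poly_at (c m) y p"] by simp
      also have "cmod (poly_at (c m) y p) \<le> ?norm (c m)"
        using X(1) y(1) b(2) p(1) by (rule cmod_poly_at_le_anorm)
      finally show "cmod (poly_at b x p) \<le> ?norm (c m) + \<epsilon> / 2" by simp
    qed
    moreover have "?norm (c m) \<le> ?norm b + \<epsilon> / 2"
    proof (rule anorm_poly_val_leI[OF X(2)])
      fix y assume y: "y \<in> topspace X"
      then obtain x where x: "x \<in> topspace X" "R' m x y"
        using R unfolding matched_def R'_def by blast
      have "cmod (poly_at (c m) y p) \<le> cmod (poly_at b x p) + \<epsilon> / 2"
        using close[rule_format, OF x(2)] norm_triangle_ineq3[of "poly_at b x p" "poly_at (c m) y p"] by simp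
      also have "cmod (poly_at b x p) \<le> ?norm b"
        using X(1) x(1) b(1) p(1) by (rule cmod_poly_at_le_anorm)
      finally show "cmod (poly_at (c m) y p) \<le> ?norm b + \<epsilon> / 2" by simp
    qed
    ultimately show "dist (?norm (c m)) (?norm b) < \<epsilon>"
      using \<open>\<epsilon> > 0\<close> by (simp add: dist_real_def abs_if)
  qed
qed

lemma tendsto_continuous_map_Euclidean_space:
  assumes u: "continuous_map (Euclidean_space n) euclideanreal u"
    and "\<And>i. i < n \<Longrightarrow> (\<lambda>m. s m i) \<longlonglongrightarrow> t i"
  shows "(\<lambda>m. u (\<lambda>i. if i < n then s m i else 0)) \<longlonglongrightarrow> u (\<lambda>i. if i < n then t i else 0)"
proof -
  have "(\<lambda>m. if i < n then s m i else 0) \<longlonglongrightarrow> (if i < n then t i else 0)" for i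
    using assms(2) by auto
  then have "limitin (powertop_real UNIV) (\<lambda>m i. if i < n then s m i else 0) (\<lambda>i. if i < n then t i else 0) sequentially"
    by (subst limitin_componentwise) auto
  then have "limitin (Euclidean_space n) (\<lambda>m i. if i < n then s m i else 0) (\<lambda>i. if i < n then t i else 0) sequentially"
    unfolding Euclidean_space_def limitin_subtopology by auto
  from continuous_map_limit[OF u this] show ?thesis
    by (simp add: o_def)
qed

lemma cformula_val_tendsto:
  assumes X: "compact_space X" "topspace X \<noteq> {}" and R: "matched X R"
    and b: "\<And>k. b k \<in> unit_ball (continuous_functions X)" "\<And>m k. c m k \<in> unit_ball (continuous_functions X)"
      "\<And>k. asymptotically_equal X R (b k) (\<lambda>m. c m k)"
    and "\<phi> \<in> quantifier_free_formulas (continuous_functions X)"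
    and "\<And>f. f \<in> set_cformula \<phi> \<Longrightarrow> asymptotically_equal X R f (\<lambda>m. f)"
  shows "(\<lambda>m. cformula_val (continuous_functions X) (c m) \<phi>) \<longlonglongrightarrow> cformula_val (continuous_functions X) b \<phi>"
  using assms(7,8)
proof (induction \<phi>)
  case (CNorm p)
  then show ?case
    by (auto intro!: anorm_poly_val_tendsto X R b simp: quantifier_free_formulas_def all_formulas_def)
next
  case (CApply u \<phi>s)
  have "(\<lambda>m. cformula_val (continuous_functions X) (c m) (\<phi>s ! i)) \<longlonglongrightarrow>
      cformula_val (continuous_functions X) b (\<phi>s ! i)" if "i < length \<phi>s" for i
  proof (rule CApply.IH)
    show mem: "\<phi>s ! i \<in> set \<phi>s" using that by simp
    then show "\<phi>s ! i \<in> quantifier_free_formulas (continuous_functions X)"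
      using CApply.prems(1) by (auto simp: quantifier_free_formulas_def all_formulas_def)
    show "asymptotically_equal X R f (\<lambda>m. f)" if "f \<in> set_cformula (\<phi>s ! i)" for f
      using CApply.prems(2) that mem by auto
  qed
  then show ?case
    using CApply.prems(1) unfolding cformula_val.simps
    by (intro tendsto_continuous_map_Euclidean_space)
      (auto simp: quantifier_free_formulas_def all_formulas_def)
qed (auto simp: quantifier_free_formulas_def)

text \<open>Realized digits describe some continuous function; the norm bound passes to the limit.\<close>

lemma in_unit_ball_if_asymptotically_equal:
  assumes X: "compact_space X" "topspace X \<noteq> {}" and R: "matched X R"
    and f: "f \<in> extensional (topspace X)" "continuous_map X euclidean f"
    and g: "\<And>m. g m \<in> unit_ball (continuous_functions X)" "asymptotically_equal X R f g"
  shows "f \<in> unit_ball (continuous_functions X)"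
proof -
  note ball = unit_ball_continuous_functions[OF X]
  have "cmod (f x) \<le> 1" if x: "x \<in> topspace X" for x
  proof -
    have "\<forall>m. \<exists>y. y \<in> topspace X \<and> R m x y"
      using R x unfolding matched_def by blast
    then obtain y where y: "\<And>m. y m \<in> topspace X \<and> R m x (y m)"
      by metis
    have "(\<lambda>m. f x - g m (y m)) \<longlonglongrightarrow> 0"
      using g(2)[unfolded asymptotically_equal_def, rule_format, of "\<lambda>m. x" y] x y by simp
    then have "(\<lambda>m. cmod (f x - g m (y m)) + 1) \<longlonglongrightarrow> 0 + 1"
      by (intro tendsto_add tendsto_const tendsto_norm_zero)
    moreover have "cmod (f x) \<le> cmod (f x - g m (y m)) + 1" for m
    proof -
      have "cmod (g m (y m)) \<le> 1"
        using g(1) ball y by blast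
      then show ?thesis
        using norm_triangle_ineq2[of "f x" "g m (y m)"] by simp
    qed
    ultimately show ?thesis
      by (intro LIMSEQ_le_const) auto
  qed
  then show ?thesis
    using f ball by blast
qed

text \<open>Here \<open>h i\<close> is the position of the \<open>i\<close>-th digit in the enumeration of all digits. The first \<open>n\<close>
  digits, which determine the value up to \<open>\<epsilon>\<close>, are among the first \<open>m\<close> once \<open>m\<close> is large.\<close>

lemma asymptotically_equal_function_of_digits:
  assumes "\<And>m x y. R m x y \<Longrightarrow> x \<in> topspace X \<Longrightarrow> y \<in> topspace X \<Longrightarrow>
      \<forall>i. h i < m \<longrightarrow> (x \<in> U i \<longleftrightarrow> y \<in> U' m i)"
  shows "asymptotically_equal X R (function_of_digits X U) (\<lambda>m. function_of_digits X (U' m))"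
  unfolding asymptotically_equal_def
proof (intro allI impI tendstoI)
  fix x y and \<epsilon> :: real
  assume xy: "\<forall>m. x m \<in> topspace X \<and> y m \<in> topspace X \<and> R m (x m) (y m)" and "\<epsilon> > 0"
  then obtain n where n: "\<And>d d'. (\<forall>i<n. d i = d' i) \<Longrightarrow> cmod (complex_of_digits d - complex_of_digits d') < \<epsilon>"
    using complex_of_digits_close by metis
  obtain M where M: "\<And>i. i < n \<Longrightarrow> h i < M"
    using finite_nat_set_iff_bounded[of "h ` {..<n}"] by auto
  have "dist (function_of_digits X U (x m) - function_of_digits X (U' m) (y m)) 0 < \<epsilon>" if "m \<ge> M" for m
  proof -
    have "\<forall>i<n. (x m \<in> U i) = (y m \<in> U' m i)"
      using assms[of m "x m" "y m"] xy M that less_le_trans by blast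
    from n[of "\<lambda>i. x m \<in> U i" "\<lambda>i. y m \<in> U' m i", OF this] show ?thesis
      using xy by (simp add: function_of_digits_def)
  qed
  then show "\<forall>\<^sub>F m in sequentially. dist (function_of_digits X U (x m) - function_of_digits X (U' m) (y m)) 0 < \<epsilon>"
    by (auto simp: eventually_sequentially)
qed

section \<open>Saturation\<close>

lemma in_closed_if_tendsto_thickening:
  assumes "closed K" "s \<longlonglongrightarrow> l" "\<And>\<epsilon>. \<epsilon> > 0 \<Longrightarrow> \<forall>\<^sub>F m in sequentially. s m \<in> thickening K \<epsilon>"
  shows "l \<in> K"
proof -
  have "\<exists>y\<in>K. dist y l < \<epsilon>" if "\<epsilon> > 0" for \<epsilon>
  proof -
    have "\<forall>\<^sub>F m in sequentially. dist (s m) l < \<epsilon> / 2 \<and> s m \<in> thickening K (\<epsilon> / 2)"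
      using that by (intro eventually_conj tendstoD[OF assms(2)] assms(3)) auto
    then obtain m where "dist (s m) l < \<epsilon> / 2" "s m \<in> thickening K (\<epsilon> / 2)"
      using eventually_happens'[OF sequentially_bot] by blast
    then show ?thesis
      unfolding thickening_def using dist_triangle_half_l[of _ "s m" \<epsilon> l]
      by (force simp: dist_commute)
  qed
  then show ?thesis
    using closed_approachable[OF assms(1)] by blast
qed

lemma thickening_mono: "\<epsilon> \<le> \<epsilon>' \<Longrightarrow> thickening K \<epsilon> \<subseteq> thickening K \<epsilon>'"
  unfolding thickening_def by (intro UN_mono) auto

text \<open>Only parameters that occur in the type need digits, and there are countably many of them, so all
  digits together are indexed by natural numbers.\<close>

lemma countably_qf_saturated_continuous_functions:
  assumes X: "compact_space X" "topspace X \<noteq> {}" "zero_dimensional X"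
    and sat: "countably_saturated_ba (clopen_algebra X)"
  shows "countably_qf_saturated (continuous_functions X)"
  unfolding countably_qf_saturated_def countably_saturated_for_def
proof (intro allI impI iffI; elim conjE)
  let ?A = "continuous_functions X"
  fix \<phi> :: "nat \<Rightarrow> ('a \<Rightarrow> complex) cformula" and K :: "nat \<Rightarrow> real set" and \<epsilon> :: real and \<Delta> :: "nat set"
  assume b: "\<exists>b. (\<forall>k. b k \<in> unit_ball ?A) \<and> (\<forall>n. cformula_val ?A b (\<phi> n) \<in> K n)" and "\<epsilon> > 0"
  then show "\<exists>b. (\<forall>k. b k \<in> unit_ball ?A) \<and> (\<forall>n\<in>\<Delta>. cformula_val ?A b (\<phi> n) \<in> thickening (K n) \<epsilon>)"
    unfolding thickening_def by (meson UN_I centre_in_ball)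
next
  let ?A = "continuous_functions X"
  fix \<phi> :: "nat \<Rightarrow> ('a \<Rightarrow> complex) cformula" and K :: "nat \<Rightarrow> real set"
  assume \<phi>: "\<forall>n. \<phi> n \<in> quantifier_free_formulas ?A" and K: "\<forall>n. compact (K n)"
    and approx: "\<forall>\<epsilon>>0. \<forall>\<Delta>. finite \<Delta> \<longrightarrow> (\<exists>b. (\<forall>k. b k \<in> unit_ball ?A) \<and>
          (\<forall>n\<in>\<Delta>. cformula_val ?A b (\<phi> n) \<in> thickening (K n) \<epsilon>))"
  have "\<exists>b. (\<forall>k. b k \<in> unit_ball ?A) \<and>
      (\<forall>n<N. cformula_val ?A b (\<phi> n) \<in> thickening (K n) (1 / real (Suc N)))" for N
    using approx[rule_format, of "1 / real (Suc N)" "{..<N}"] by auto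
  then obtain c where c: "\<And>N k. c N k \<in> unit_ball ?A"
    "\<And>N n. n < N \<Longrightarrow> cformula_val ?A (c N) (\<phi> n) \<in> thickening (K n) (1 / real (Suc N))"
    by metis
  \<comment> \<open>The function 0 only makes \<open>P\<close> nonempty, so that it can be enumerated.\<close>
  define P where "P = insert (char_fun X {}) (\<Union>n. set_cformula (\<phi> n))"
  have "finite (set_star_poly p)" for p :: "('a \<Rightarrow> complex) star_poly"
    by (induction p) auto
  then have "finite (set_cformula \<psi>)" for \<psi> :: "('a \<Rightarrow> complex) cformula"
    by (induction \<psi>) auto
  then have "countable P"
    unfolding P_def by (intro countable_insert countable_UN) (auto intro: countable_finite)
  define a where "a = from_nat_into P"
  have a: "range a = P"
    unfolding a_def using \<open>countable P\<close> by (intro range_from_nat_into) (auto simp: P_def)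
  have "P \<subseteq> unit_ball ?A"
    using \<phi> char_fun_in_unit_ball[OF X(1,2), of "{}"]
    by (auto simp: P_def quantifier_free_formulas_def all_formulas_def clopen_def)
  then have "\<forall>j. \<exists>U. (\<forall>i. clopen X (U i)) \<and> a j = function_of_digits X U"
    using unit_ball_digit_expansion[OF X] a by blast
  then obtain W where W: "\<And>j i. clopen X (W j i)" "\<And>j. a j = function_of_digits X (W j)"
    by metis
  have "\<forall>N k. \<exists>U. (\<forall>i. clopen X (U i)) \<and> c N k = function_of_digits X U"
    using unit_ball_digit_expansion[OF X] c(1) by blast
  then obtain V where V: "\<And>N k i. clopen X (V N k i)" "\<And>N k. c N k = function_of_digits X (V N k)"
    by metis
  define flat :: "(nat \<Rightarrow> nat \<Rightarrow> 'a set) \<Rightarrow> nat \<Rightarrow> 'a set" where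
    "flat U j = U (fst (prod_decode j)) (snd (prod_decode j))" for U j
  have flat: "flat U (prod_encode (k, i)) = U k i" for U k i
    by (simp add: flat_def)
  obtain v r where v: "\<And>j. clopen X (v j)" and r: "\<And>m. m \<le> r m"
    and R: "matched X (\<lambda>m. same_digits m (flat W) v (flat (V (r m))))"
    using realize_digit_patterns[OF sat, of "\<lambda>N. flat (V N)" "flat W"] V(1) W(1)
    unfolding flat_def by blast
  let ?R = "\<lambda>m. same_digits m (flat W) v (flat (V (r m)))"
  have digits: "x \<in> v (prod_encode (k, i)) \<longleftrightarrow> y \<in> V (r m) k i" "x \<in> W k i \<longleftrightarrow> y \<in> W k i"
    if "?R m x y" "prod_encode (k, i) < m" for m x y k i
    using that unfolding same_digits_def by (metis flat)+
  define b where "b k = function_of_digits X (\<lambda>i. v (prod_encode (k, i)))" for k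
  have b_c: "asymptotically_equal X ?R (b k) (\<lambda>m. c (r m) k)" for k
    unfolding b_def V(2)
    by (rule asymptotically_equal_function_of_digits[where h = "\<lambda>i. prod_encode (k, i)"])
      (use digits in blast)
  have b: "b k \<in> unit_ball ?A" for k
  proof (rule in_unit_ball_if_asymptotically_equal[OF X(1,2) R _ _ c(1) b_c])
    show "b k \<in> extensional (topspace X)"
      by (simp add: b_def function_of_digits_def)
    show "continuous_map X euclidean (b k)"
      unfolding b_def by (intro continuous_map_function_of_digits v)
  qed
  have param: "asymptotically_equal X ?R f (\<lambda>m. f)" if f: "f \<in> P" for f
  proof -
    obtain j where j: "f = a j" using f a by blast
    show ?thesis
      unfolding j W(2)
      by (rule asymptotically_equal_function_of_digits[where h = "\<lambda>i. prod_encode (j, i)"])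
        (use digits in blast)
  qed
  have "cformula_val ?A b (\<phi> n) \<in> K n" for n
  proof (rule in_closed_if_tendsto_thickening)
    show "closed (K n)" using K compact_imp_closed by blast
    show "(\<lambda>m. cformula_val ?A (c (r m)) (\<phi> n)) \<longlonglongrightarrow> cformula_val ?A b (\<phi> n)"
      using \<phi> by (intro cformula_val_tendsto[OF X(1,2) R b c(1) b_c] param) (auto simp: P_def)
    fix \<epsilon> :: real assume "\<epsilon> > 0"
    then obtain M where M: "1 / real (Suc M) < \<epsilon>"
      using nat_approx_posE by blast
    have "cformula_val ?A (c (r m)) (\<phi> n) \<in> thickening (K n) \<epsilon>" if "m \<ge> max M (Suc n)" for m
    proof -
      have "1 / real (Suc (r m)) \<le> 1 / real (Suc M)"
        using that r[of m] by (intro divide_left_mono) auto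
      then show ?thesis
        using c(2)[of n "r m"] that r[of m] M thickening_mono[of "1 / real (Suc (r m))" \<epsilon> "K n"] by auto
    qed
    then show "\<forall>\<^sub>F m in sequentially. cformula_val ?A (c (r m)) (\<phi> n) \<in> thickening (K n) \<epsilon>"
      unfolding eventually_sequentially by blast
  qed
  then show "\<exists>b. (\<forall>k. b k \<in> unit_ball ?A) \<and> (\<forall>n. cformula_val ?A b (\<phi> n) \<in> K n)"
    using b by blast
qed

lemma countably_saturated_ba_clopen_algebra:
  assumes X: "compact_space X" "topspace X \<noteq> {}" and sat: "countably_saturated (continuous_functions X)"
  shows "countably_saturated_ba (clopen_algebra X)"
  unfolding countably_saturated_ba_def
proof (intro allI impI; elim conjE)
  let ?A = "continuous_functions X" and ?B = "clopen_algebra X"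
  fix T :: "'a set bformula set"
  assume T: "countable T" "\<forall>\<phi>\<in>T. set_bformula \<phi> \<subseteq> carrier ?B"
    and fin: "\<forall>F. finite F \<and> F \<subseteq> T \<longrightarrow>
        (\<exists>v :: nat \<Rightarrow> 'a set. (\<forall>k. v k \<in> carrier ?B) \<and> (\<forall>\<phi>\<in>F. bformula_holds ?B v \<phi>))"
  show "\<exists>v :: nat \<Rightarrow> 'a set. (\<forall>k. v k \<in> carrier ?B) \<and> (\<forall>\<phi>\<in>T. bformula_holds ?B v \<phi>)"
  proof (cases "T = {}")
    case True
    then show ?thesis using fin by blast
  next
    case False
    define \<phi> where "\<phi> = from_nat_into T"
    have \<phi>: "range \<phi> = T"
      using False T(1) by (simp add: \<phi>_def range_from_nat_into)
    have "\<forall>n. \<exists>\<psi>. \<psi> \<in> all_formulas ?A \<and> (\<exists>\<delta>>0. \<forall>a U. close_to_sets X \<delta> a U \<longrightarrow>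
      cformula_val ?A a \<psi> = of_bool (\<not> bformula_holds ?B U (\<phi> n)))"
      using bformula_as_cformula[OF X] T(2) \<phi> by blast
    then obtain \<psi> where \<psi>: "\<And>n. \<psi> n \<in> all_formulas ?A" "\<And>n. \<exists>\<delta>>0. \<forall>a U. close_to_sets X \<delta> a U \<longrightarrow>
      cformula_val ?A a (\<psi> n) = of_bool (\<not> bformula_holds ?B U (\<phi> n))"
      by metis
    have \<psi>_val: "cformula_val ?A (\<lambda>k. char_fun X (U k)) (\<psi> n) = of_bool (\<not> bformula_holds ?B U (\<phi> n))"
      if "\<And>k. clopen X (U k)" for U n
    proof -
      obtain \<delta> where \<delta>: "\<delta> > 0" "\<And>a U. close_to_sets X \<delta> a U \<Longrightarrow>
          cformula_val ?A a (\<psi> n) = of_bool (\<not> bformula_holds ?B U (\<phi> n))"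
        using \<psi>(2)[of n] by blast
      show ?thesis
        using \<delta>(1) that by (intro \<delta>(2)) (simp add: close_to_sets_def char_fun_in_unit_ball[OF X])
    qed
    \<comment> \<open>Even indices carry the translated formulas, odd ones force the variables to be idempotent.\<close>
    define \<theta> where "\<theta> m = (if even m then \<psi> (m div 2) else CNorm (idempotence_defect (m div 2)))" for m
    have "\<forall>m. \<theta> m \<in> all_formulas ?A"
      using \<psi>(1) by (simp add: \<theta>_def all_formulas_def)
    moreover have "\<exists>b. (\<forall>k. b k \<in> unit_ball ?A) \<and> (\<forall>m\<in>\<Delta>. cformula_val ?A b (\<theta> m) \<in> thickening {0} \<epsilon>)"
      if \<epsilon>: "\<epsilon> > 0" and \<Delta>: "finite \<Delta>" for \<epsilon> and \<Delta> :: "nat set"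
    proof -
      have sub: "(\<lambda>m. \<phi> (m div 2)) ` \<Delta> \<subseteq> T"
        using \<phi> by blast
      obtain U where U: "\<And>k. clopen X (U k)" "\<And>m. m \<in> \<Delta> \<Longrightarrow> bformula_holds ?B U (\<phi> (m div 2))"
        using fin[rule_format, of "(\<lambda>m. \<phi> (m div 2)) ` \<Delta>"] \<Delta> sub by auto
      have "cformula_val ?A (\<lambda>k. char_fun X (U k)) (\<theta> m) = 0" if "m \<in> \<Delta>" for m
      proof (cases "even m")
        case True
        then show ?thesis
          using U(2)[OF that] \<psi>_val[of U "m div 2"] U(1) by (simp add: \<theta>_def)
      next
        case False
        let ?f = "char_fun X (U (m div 2))"
        have "(SUP x\<in>topspace X. cmod (?f x * (?f x - 1))) = (SUP x\<in>topspace X. 0)"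
          by (rule SUP_cong) (simp_all add: char_fun_def)
        then show ?thesis
          using False X(2) by (simp add: \<theta>_def anorm_poly_val)
      qed
      then show ?thesis
        using \<epsilon> U(1) char_fun_in_unit_ball[OF X]
        by (intro exI[of _ "\<lambda>k. char_fun X (U k)"]) (auto simp: thickening_def)
    qed
    ultimately obtain b where b: "\<And>k. b k \<in> unit_ball ?A" "\<And>m. cformula_val ?A b (\<theta> m) = 0"
      using sat[unfolded countably_saturated_def countably_saturated_for_def, rule_format, of \<theta> "\<lambda>_. {0}"]
      by auto
    have defect: "anorm ?A (poly_val ?A b (idempotence_defect k)) = 0" for k
      using b(2)[of "2 * k + 1"] by (simp add: \<theta>_def)
    have "\<exists>U. clopen X U \<and> b k = char_fun X U" for k
    proof -
      obtain U where U: "clopen X U" "\<And>x. x \<in> topspace X \<Longrightarrow> cmod (b k x - char_fun X U x) < 1 / 2"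
        using almost_idempotent_close_to_char_fun[OF X, of b "1 / 2" k] b(1) defect[of k] by auto
      have "b k x = char_fun X U x" if x: "x \<in> topspace X" for x
      proof -
        have "b k x * (b k x - 1) = 0"
          using cmod_poly_at_le_anorm[OF X(1) x, of b "idempotence_defect k"] b(1) defect[of k] by simp
        then have "b k x = 0 \<or> b k x = 1" by simp
        then show ?thesis
          using U(2)[OF x] x by (auto simp: char_fun_def split: if_splits)
      qed
      moreover have "b k \<in> extensional (topspace X)" "char_fun X U \<in> extensional (topspace X)"
        using b(1) unit_ball_continuous_functions[OF X] by (auto simp: char_fun_def)
      ultimately show ?thesis
        using U(1) extensionalityI by blast
    qed
    then obtain U where U: "\<And>k. clopen X (U k)" "\<And>k. b k = char_fun X (U k)"
      by metis
    have "bformula_holds ?B U (\<phi> n)" for n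
    proof -
      have "b = (\<lambda>k. char_fun X (U k))"
        using U(2) by auto
      then show ?thesis
        using \<psi>_val[of U n] U(1) b(2)[of "2 * n"] by (simp add: \<theta>_def)
    qed
    then show ?thesis
      using U(1) \<phi> by auto
  qed
qed

theorem theorem5p13:
  fixes X :: "'x topology"
  assumes "compact_space X" and "Hausdorff_space X" and "zero_dimensional X"
    and "infinite (topspace X)"
  shows "(countably_saturated (continuous_functions X) \<longrightarrow> countably_saturated_ba (clopen_algebra X))
    \<and> (countably_saturated_ba (clopen_algebra X) \<longrightarrow> countably_qf_saturated (continuous_functions X))"
proof -
  have "topspace X \<noteq> {}"
    using assms(4) by auto
  then show ?thesis
    using countably_saturated_ba_clopen_algebra[OF assms(1)]
      countably_qf_saturated_continuous_functions[OF assms(1) _ assms(3)] by blast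
qed

end
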